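(* Let $(X_n)_{n\in\mathbb{N}}$ be a critical Galton-Watson process with immigration, $$X_{n+1}=\sum_{k=1}^{X_n}\xi_{k,n}+I_n,$$ where $(\xi_{k,n})_{k,n\in\mathbb{N}}$ are i.i.d. nonnegative-integer-valued random variables with $\mathbb{E}(\xi_{1,1})=1$, $\mathrm{Var}(\xi_{1,1})=d>0$ and $\mathbb{E}(\xi_{1,1}^{2+\delta})<\infty$ for some $\delta>0$, $(I_n)_{n\in\mathbb{N}}$ are i.i.d. nonnegative-integer-valued random variables with $\mathbb{E}(I_1)=c>0$ and $\mathbb{E}(I_1^{2+\delta})<\infty$, and the variables $(\xi_{k,n})_{k,n\in\mathbb{N}}$ and $(I_n)_{n\in\mathbb{N}}$ are independent. Assume $\theta=\frac{2c}{d}<1$. Then there exists $A>0$ such that for all $x_0>A$ and all $\alpha,\beta$ with $\alpha<1-\theta<\beta$, there exist positive constants $C_\alpha$ and $C_\beta$ such that for all $n\ge 1$, $$\frac{C_\beta}{n^{\beta}}\le\mathbb{P}_{x_0}(\tau_A>n)\le\frac{C_\alpha}{n^{\alpha}}.$$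
   Context: $\mathbb{P}_{x_0}$ denotes the law of the process started from the integer $X_0=x_0$, and $\tau_A=\inf\{n\in\mathbb{N}: X_n\le A\}$. *)

theory Defs
  imports "HOL-Probability.Probability"
begin

text \<open>
  Joint independence of the whole family (\<open>Inl (k, n)\<close> indexes \<open>\<xi> k n\<close>, \<open>Inr n\<close> indexes \<open>I n\<close>)
  expresses at once that the \<open>\<xi> k n\<close> are independent, that the \<open>I n\<close> are independent, and that
  the two families are independent of each other.
\<close>

locale gw_immigration = prob_space M for M :: "'a measure" +
  fixes \<xi> :: "nat \<Rightarrow> nat \<Rightarrow> 'a \<Rightarrow> nat" and I :: "nat \<Rightarrow> 'a \<Rightarrow> nat"
  assumes indep: "indep_vars (\<lambda>_. count_space UNIV) (case_sum (\<lambda>(k, n). \<xi> k n) I) UNIV"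
    and \<xi>_identically_distributed:
      "\<And>k n. distr M (count_space UNIV) (\<xi> k n) = distr M (count_space UNIV) (\<xi> 1 1)"
    and I_identically_distributed:
      "\<And>n. distr M (count_space UNIV) (I n) = distr M (count_space UNIV) (I 1)"

primrec gw_process ::
  "(nat \<Rightarrow> nat \<Rightarrow> 'a \<Rightarrow> nat) \<Rightarrow> (nat \<Rightarrow> 'a \<Rightarrow> nat) \<Rightarrow> nat \<Rightarrow> nat \<Rightarrow> 'a \<Rightarrow> nat" where
  "gw_process \<xi> I x0 0 \<omega> = x0"
| "gw_process \<xi> I x0 (Suc n) \<omega> = (\<Sum>k=1..gw_process \<xi> I x0 n \<omega>. \<xi> k n \<omega>) + I n \<omega>"

text \<open>The law on path space of the process started from \<open>x0\<close>.\<close>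

definition gw_law ::
  "'a measure \<Rightarrow> (nat \<Rightarrow> nat \<Rightarrow> 'a \<Rightarrow> nat) \<Rightarrow> (nat \<Rightarrow> 'a \<Rightarrow> nat) \<Rightarrow> nat \<Rightarrow> (nat \<Rightarrow> nat) measure" where
  "gw_law M \<xi> I x0 =
     distr M (\<Pi>\<^sub>M n\<in>UNIV. count_space UNIV) (\<lambda>\<omega> n. gw_process \<xi> I x0 n \<omega>)"

text \<open>In \<open>enat\<close>, the infimum of the empty set is \<open>\<infinity>\<close>.\<close>

definition hitting_time :: "real \<Rightarrow> (nat \<Rightarrow> nat) \<Rightarrow> enat" where
  "hitting_time A X = Inf {enat n | n. real (X n) \<le> A}"

end

theory Submission
  imports Defs
begin

text \<open>
  Write \<open>X'\<close> for the generation that follows one of size \<open>x\<close>. The increment \<open>X' - x\<close> has mean \<open>c\<close> and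
  variance \<open>d x + O(1)\<close>, so a second-order expansion gives, for \<open>0 < q < 1\<close>,
  \<open>E X'^q = x^q + q (q - p) (d / 2) x^(q - 1) + o(x^(q - 1))\<close> with \<open>p = 1 - 2 c / d\<close>. Thus \<open>x^q\<close> is
  a supermartingale far from the origin if \<open>q < p\<close> and a submartingale there if \<open>q > p\<close>; this is
  where the exponent \<open>1 - \<theta>\<close> comes from (lemma \<open>powr_drift\<close>). The moment of order above two makes
  the remainder of the expansion negligible.

  Upper bound. For \<open>0 < \<alpha> < p\<close> the drift of \<open>x^\<alpha>\<close> is at most \<open>- \<kappa> x^(\<alpha> - 1)\<close>, but only beyond a
  level that depends on \<open>\<alpha>\<close>, whereas \<open>A\<close> has to serve all exponents at once. Since the process falls
  to \<open>A\<close> in one step with probability bounded below on any bounded set, a large constant reward for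
  staying above \<open>A\<close> repairs the drift between \<open>A\<close> and that level (lemma \<open>Lyapunov_function\<close>). A path
  surviving for \<open>n\<close> steps either reaches level \<open>n\<close>, which costs \<open>V(x0) / n^\<alpha>\<close> for a nonnegative
  supermartingale \<open>V\<close> of order \<open>x^\<alpha>\<close>, or spends \<open>n\<close> steps below \<open>n\<close> with a drift of at most
  \<open>- \<kappa> n^(\<alpha> - 1)\<close>, which by Markov's inequality costs \<open>V(x0) n^(1 - \<alpha>) / (\<kappa> n)\<close>. Both are of order
  \<open>n^(-\<alpha>)\<close> (lemma \<open>survival_upper_bound\<close>).

  Lower bound. For \<open>p < \<beta> < 1\<close> the expectation of \<open>X_n^\<beta>\<close> on survival stays bounded below (lemma
  \<open>surviving_power_mean\<close>), while that of \<open>X_n\<close> grows by at most \<open>c\<close> times the survival probability in each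
  step and is therefore \<open>O(n^(1 - \<alpha>))\<close> by the upper bound (lemma \<open>surviving_mean\<close>). Comparing the
  two through \<open>x^\<beta> \<le> K^\<beta> + K^(\<beta> - 1) x\<close> with the best \<open>K\<close> bounds the survival probability below by
  a multiple of \<open>n\<close> to the power \<open>- \<beta> (1 - \<alpha>) / (1 - \<beta>)\<close>, and this exponent tends to \<open>- p\<close> as \<open>\<alpha>\<close>
  and \<open>\<beta>\<close> approach \<open>p\<close> (lemma \<open>survival_lower_bound\<close>).
\<close>

section \<open>Expansions of power functions\<close>

lemma one_plus_powr_Taylor:
  fixes r t :: real
  assumes r: "0 \<le> r" "r \<le> 3" and t: "\<bar>t\<bar> \<le> 1/2"
  shows "\<bar>(1 + t) powr r - 1 - r * t - r * (r - 1) / 2 * t\<^sup>2\<bar> \<le> 16 * \<bar>t\<bar> ^ 3"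
proof (cases "t = 0")
  case False
  define D :: "nat \<Rightarrow> real \<Rightarrow> real"
    where "D m s = (\<Prod>i<m. r - real i) * (1 + s) powr (r - real m)" for m s
  have deriv: "DERIV (D m) s :> D (Suc m) s" if "- (1/2) \<le> s" for m s
    unfolding D_def using that
    by (auto intro!: derivative_eq_intros simp: algebra_simps)
  have "\<exists>s. (if t < 0 then t < s \<and> s < 0 else 0 < s \<and> s < t) \<and>
      (1 + t) powr r = (\<Sum>m<3. D m 0 / fact m * (t - 0) ^ m) + D 3 s / fact 3 * (t - 0) ^ 3"
    by (rule Taylor[where a = "-(1/2)" and b = "1/2" and diff = D])
       (use t False deriv in \<open>auto simp: D_def fun_eq_iff\<close>)
  then obtain s where "if t < 0 then t < s \<and> s < 0 else 0 < s \<and> s < t" and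
    eq: "(1 + t) powr r = (\<Sum>m<3. D m 0 / fact m * (t - 0) ^ m) + D 3 s / fact 3 * (t - 0) ^ 3"
    by (elim exE conjE)
  then have s: "\<bar>s\<bar> \<le> 1/2"
    using t by (auto split: if_splits)
  have sum: "(\<Sum>m<3. D m 0 / fact m * (t - 0) ^ m) = 1 + r * t + r * (r - 1) / 2 * t\<^sup>2"
    by (simp add: D_def eval_nat_numeral)
  have "(1 + s) powr (r - 3) \<le> (1/2) powr (r - 3)"
    using s r by (intro powr_mono2') auto
  also have "\<dots> \<le> (1/2) powr (-3)"
    using r by (intro powr_mono') auto
  also have "\<dots> = 8"
    by (simp add: powr_minus powr_numeral power_divide)
  finally have p8: "(1 + s) powr (r - 3) \<le> 8" .
  have "\<bar>r\<bar> * \<bar>r - 1\<bar> * \<bar>r - 2\<bar> \<le> 3 * 2 * 2"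
    using r by (intro mult_mono) auto
  then have "\<bar>r\<bar> * \<bar>r - 1\<bar> * \<bar>r - 2\<bar> * (1 + s) powr (r - 3) \<le> 12 * 8"
    using p8 by (intro mult_mono) auto
  moreover have "(\<Prod>i<3. r - real i) = r * (r - 1) * (r - 2)"
    by (simp add: eval_nat_numeral)
  ultimately have "\<bar>D 3 s\<bar> \<le> 12 * 8"
    by (simp add: D_def abs_mult)
  then have "\<bar>D 3 s / fact 3 * (t - 0) ^ 3\<bar> \<le> 16 * \<bar>t\<bar> ^ 3"
    by (simp add: abs_mult power_abs fact_numeral mult_right_mono)
  then show ?thesis
    unfolding eq sum by simp
qed simp

text \<open>
  Away from the origin every term of the expansions below, constants included, is absorbed by the
  remainder \<open>u powr r\<close>.
\<close>

lemma powr_le_powr_of_ge_half: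
  fixes u :: real
  assumes u: "u > 1/2" and k: "0 \<le> k" "k \<le> r" and r: "r \<le> 3"
  shows "u powr k \<le> 8 * u powr r"
proof -
  have "u powr k * 2 powr k = (2 * u) powr k"
    using u by (simp add: powr_mult)
  also have "\<dots> \<le> (2 * u) powr r"
    using u k by (intro powr_mono) auto
  also have "\<dots> = 2 powr r * u powr r"
    using u by (simp add: powr_mult)
  also have "\<dots> \<le> 8 * u powr r"
    using powr_mono[of r 3 "2::real"] r by (intro mult_right_mono) auto
  finally have *: "u powr k * 2 powr k \<le> 8 * u powr r" .
  have "u powr k * 1 \<le> u powr k * 2 powr k"
    using k by (intro mult_left_mono ge_one_powr_ge_zero) auto
  with * show ?thesis by simp
qed

lemma abs_cube_le_powr:
  fixes t :: real
  assumes "\<bar>t\<bar> \<le> 1" "r \<le> 3"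
  shows "\<bar>t\<bar> ^ 3 \<le> \<bar>t\<bar> powr r"
proof (cases "t = 0")
  case False
  then have "\<bar>t\<bar> ^ 3 = \<bar>t\<bar> powr 3" by (simp flip: powr_numeral)
  also have "\<dots> \<le> \<bar>t\<bar> powr r" using assms False by (intro powr_mono') auto
  finally show ?thesis .
qed simp

text \<open>
  The remainder has order \<open>r\<close> and not three, because only moments of order \<open>r\<close> are at hand. Near zero
  this is Taylor's formula; elsewhere each term on the left is at most a multiple of the right side.
\<close>

lemma concave_powr_expansion:
  fixes q r t :: real
  assumes q: "0 < q" "q < 1" and r: "2 < r" "r \<le> 3" and t: "-1 \<le> t"
  shows "\<bar>(1 + t) powr q - 1 - q * t - q * (q - 1) / 2 * t\<^sup>2\<bar> \<le> 50 * \<bar>t\<bar> powr r"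
proof (cases "\<bar>t\<bar> \<le> 1/2")
  case True
  then have "\<bar>(1 + t) powr q - 1 - q * t - q * (q - 1) / 2 * t\<^sup>2\<bar> \<le> 16 * \<bar>t\<bar> ^ 3"
    using q by (intro one_plus_powr_Taylor) auto
  also have "\<dots> \<le> 50 * \<bar>t\<bar> powr r"
    using abs_cube_le_powr[of t r] True r powr_ge_zero[of "\<bar>t\<bar>" r] by linarith
  finally show ?thesis .
next
  case False
  define u where "u = \<bar>t\<bar>"
  have u: "u > 1/2" using False by (simp add: u_def)
  have u0: "1 \<le> 8 * u powr r" and u1: "u \<le> 8 * u powr r" and u2: "u\<^sup>2 \<le> 8 * u powr r"
    using powr_le_powr_of_ge_half[of u 0 r] powr_le_powr_of_ge_half[of u 1 r]
      powr_le_powr_of_ge_half[of u 2 r] u r by (simp_all add: powr_numeral)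
  have "(1 + t) powr q \<le> 1 + u"
  proof -
    have "(1 + t) powr q \<le> (1 + u) powr q"
      using t q by (intro powr_mono2) (auto simp: u_def)
    also have "\<dots> \<le> (1 + u) powr 1" using q u by (intro powr_mono) auto
    finally show ?thesis using u by simp
  qed
  moreover have "\<bar>q * t\<bar> \<le> u"
    using q u mult_right_mono[of q 1 u] by (simp add: abs_mult u_def)
  moreover have "\<bar>q * (q - 1) / 2 * t\<^sup>2\<bar> \<le> u\<^sup>2"
  proof -
    have "q * (1 - q) \<le> 1 * 1" using q by (intro mult_mono) auto
    then have "q * (1 - q) / 2 * u\<^sup>2 \<le> 1 * u\<^sup>2" by (intro mult_right_mono) auto
    then show ?thesis using q by (simp add: abs_mult u_def)
  qed
  ultimately have "\<bar>(1 + t) powr q - 1 - q * t - q * (q - 1) / 2 * t\<^sup>2\<bar> \<le> (1 + u) + 1 + u + u\<^sup>2"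
    using powr_ge_zero[of "1 + t" q] by linarith
  also have "\<dots> \<le> 50 * u powr r" using u0 u1 u2 by linarith
  finally show ?thesis by (simp add: u_def)
qed

lemma abs_one_plus_powr_le:
  fixes r t :: real
  assumes r: "2 < r" "r \<le> 3"
  shows "\<bar>1 + t\<bar> powr r \<le> 1 + r * t + 60 * (t\<^sup>2 + \<bar>t\<bar> powr r)"
proof (cases "\<bar>t\<bar> \<le> 1/2")
  case True
  have "\<bar>(1 + t) powr r - 1 - r * t - r * (r - 1) / 2 * t\<^sup>2\<bar> \<le> 16 * \<bar>t\<bar> ^ 3"
    using r True by (intro one_plus_powr_Taylor) auto
  then have "(1 + t) powr r \<le> 1 + r * t + r * (r - 1) / 2 * t\<^sup>2 + 16 * \<bar>t\<bar> ^ 3"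
    by linarith
  moreover have "r * (r - 1) / 2 * t\<^sup>2 \<le> 60 * t\<^sup>2"
    using mult_mono[of r 3 "r - 1" 2] r by (intro mult_right_mono) auto
  moreover have "16 * \<bar>t\<bar> ^ 3 \<le> 60 * \<bar>t\<bar> powr r"
    using abs_cube_le_powr[of t r] True r powr_ge_zero[of "\<bar>t\<bar>" r] by linarith
  moreover have "\<bar>1 + t\<bar> = 1 + t" using True by simp
  ultimately show ?thesis by (simp add: distrib_left)
next
  case False
  define u where "u = \<bar>t\<bar>"
  have u: "u > 1/2" using False by (simp add: u_def)
  have u1: "u \<le> 8 * u powr r"
    using powr_le_powr_of_ge_half[of u 1 r] u r by simp
  have "\<bar>1 + t\<bar> powr r \<le> (3 * u) powr r"
    using u r by (intro powr_mono2) (auto simp: u_def)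
  also have "\<dots> = 3 powr r * u powr r"
    using u by (simp add: powr_mult)
  also have "\<dots> \<le> 27 * u powr r"
    using powr_mono[of r 3 "3::real"] r by (intro mult_right_mono) auto
  finally have "\<bar>1 + t\<bar> powr r \<le> 27 * u powr r" .
  moreover have "- (r * t) \<le> 3 * u"
  proof -
    have "- (r * t) \<le> \<bar>r * t\<bar>" by (rule abs_ge_minus_self)
    also have "\<dots> = r * u" using r by (simp add: abs_mult u_def)
    also have "\<dots> \<le> 3 * u" using r u by (intro mult_right_mono) auto
    finally show ?thesis .
  qed
  moreover have "0 \<le> 60 * t\<^sup>2" by simp
  ultimately have "\<bar>1 + t\<bar> powr r \<le> 1 + r * t + (60 * t\<^sup>2 + 60 * u powr r)"
    using u1 powr_ge_zero[of u r] by linarith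
  then show ?thesis by (simp add: u_def distrib_left)
qed

text \<open>
  The linear term is kept exactly: it has expectation zero when \<open>b\<close> is a centred random variable
  independent of \<open>a\<close>, and this cancellation is what makes moments of random walks grow like \<open>n^(r/2)\<close>
  and not like \<open>n^r\<close>.
\<close>

lemma abs_add_powr_le:
  fixes a b r :: real
  assumes r: "2 < r" "r \<le> 3"
  shows "\<bar>a + b\<bar> powr r \<le>
    \<bar>a\<bar> powr r + r * (sgn a * \<bar>a\<bar> powr (r - 1)) * b + 60 * (\<bar>a\<bar> powr (r - 2) * b\<^sup>2 + \<bar>b\<bar> powr r)"
proof (cases "a = 0")
  case False
  define t where "t = b / a"
  have b: "b = a * t" using False by (simp add: t_def)
  have "\<bar>a + b\<bar> powr r = \<bar>a * (1 + t)\<bar> powr r"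
    by (simp only: b distrib_left mult_1_right)
  also have "\<dots> = \<bar>a\<bar> powr r * \<bar>1 + t\<bar> powr r"
    by (simp only: abs_mult powr_mult abs_ge_zero)
  also have "\<dots> \<le> \<bar>a\<bar> powr r * (1 + r * t + 60 * (t\<^sup>2 + \<bar>t\<bar> powr r))"
    using r by (intro mult_left_mono abs_one_plus_powr_le) auto
  also have "\<dots> = \<bar>a\<bar> powr r + r * (\<bar>a\<bar> powr r * t) + 60 * (\<bar>a\<bar> powr r * t\<^sup>2 + (\<bar>a\<bar> powr r * \<bar>t\<bar> powr r))"
    by (simp add: algebra_simps)
  also have "\<bar>a\<bar> powr r * \<bar>t\<bar> powr r = \<bar>b\<bar> powr r"
    by (simp add: b powr_mult abs_mult)
  also have "\<bar>a\<bar> powr r * t = sgn a * \<bar>a\<bar> powr (r - 1) * b"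
  proof -
    have "\<bar>a\<bar> powr r = \<bar>a\<bar> powr (r - 1) * \<bar>a\<bar>"
      using False by (simp add: powr_diff)
    then show ?thesis by (simp add: b abs_sgn mult_ac)
  qed
  also have "\<bar>a\<bar> powr r * t\<^sup>2 = \<bar>a\<bar> powr (r - 2) * b\<^sup>2"
    using False by (simp add: powr_diff powr_numeral b power_mult_distrib)
  finally show ?thesis by (simp add: mult_ac)
qed simp

section \<open>Moments of sums of independent centred variables\<close>

lemma (in prob_space) integrable_abs_powr_smaller:
  fixes X :: "'a \<Rightarrow> real"
  assumes [measurable]: "X \<in> borel_measurable M"
    and int: "integrable M (\<lambda>\<omega>. \<bar>X \<omega>\<bar> powr r)" and k: "0 \<le> k" "k \<le> r"
  shows "integrable M (\<lambda>\<omega>. \<bar>X \<omega>\<bar> powr k)"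
proof (rule Bochner_Integration.integrable_bound)
  show "integrable M (\<lambda>\<omega>. 1 + \<bar>X \<omega>\<bar> powr r)" using int by auto
  have "u powr k \<le> 1 + u powr r" if "u \<ge> 0" for u :: real
  proof (cases "u \<le> 1")
    case True
    then have "u powr k \<le> 1" using that k by (intro powr_le1) auto
    then show ?thesis using powr_ge_zero[of u r] by linarith
  next
    case False
    then have "u powr k \<le> u powr r" using k by (intro powr_mono) auto
    then show ?thesis by simp
  qed
  then show "AE \<omega> in M. norm (\<bar>X \<omega>\<bar> powr k) \<le> norm (1 + \<bar>X \<omega>\<bar> powr r)"
    by (auto simp: abs_of_nonneg)
qed auto

lemma (in prob_space) indep_vars_measurable:
  assumes "indep_vars (\<lambda>_. borel) X I" "i \<in> I"
  shows "X i \<in> borel_measurable M"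
  using assms by (auto simp: indep_vars_def)

lemma (in prob_space) centred_sum_second_moment:
  fixes X :: "'i \<Rightarrow> 'a \<Rightarrow> real"
  assumes "finite J" "indep_vars (\<lambda>_. borel) X J"
    and "\<And>i. i \<in> J \<Longrightarrow> integrable M (X i)" "\<And>i. i \<in> J \<Longrightarrow> expectation (X i) = 0"
    and "\<And>i. i \<in> J \<Longrightarrow> integrable M (\<lambda>\<omega>. (X i \<omega>)\<^sup>2)"
  shows "integrable M (\<lambda>\<omega>. \<Sum>i\<in>J. X i \<omega>) \<and> expectation (\<lambda>\<omega>. \<Sum>i\<in>J. X i \<omega>) = 0 \<and>
    integrable M (\<lambda>\<omega>. (\<Sum>i\<in>J. X i \<omega>)\<^sup>2) \<and>
    expectation (\<lambda>\<omega>. (\<Sum>i\<in>J. X i \<omega>)\<^sup>2) = (\<Sum>i\<in>J. expectation (\<lambda>\<omega>. (X i \<omega>)\<^sup>2))"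
  using assms
proof (induction J rule: finite_induct)
  case (insert i J)
  let ?S = "\<lambda>\<omega>. \<Sum>i\<in>J. X i \<omega>"
  have "indep_vars (\<lambda>_. borel) X J"
    by (rule indep_vars_subset[OF insert.prems(1)]) auto
  then have IH: "integrable M ?S" "expectation ?S = 0" "integrable M (\<lambda>\<omega>. (?S \<omega>)\<^sup>2)"
    "expectation (\<lambda>\<omega>. (?S \<omega>)\<^sup>2) = (\<Sum>i\<in>J. expectation (\<lambda>\<omega>. (X i \<omega>)\<^sup>2))"
    using insert by auto
  have X: "integrable M (X i)" "expectation (X i) = 0" "integrable M (\<lambda>\<omega>. (X i \<omega>)\<^sup>2)"
    using insert.prems by auto
  have ind: "indep_var borel (X i) borel ?S"
    using insert by (intro indep_vars_sum) auto
  have XS: "integrable M (\<lambda>\<omega>. X i \<omega> * ?S \<omega>)" "expectation (\<lambda>\<omega>. X i \<omega> * ?S \<omega>) = 0"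
    using indep_var_integrable[OF ind X(1) IH(1)] indep_var_lebesgue_integral[OF ind X(1) IH(1)] X(2)
    by auto
  have sq: "(X i \<omega> + ?S \<omega>)\<^sup>2 = (X i \<omega>)\<^sup>2 + (?S \<omega>)\<^sup>2 + 2 * (X i \<omega> * ?S \<omega>)" for \<omega>
    by (simp add: power2_sum)
  show ?case
    using IH X XS insert.hyps by (simp add: sq)
qed simp

text \<open>
  A bound of Marcinkiewicz--Zygmund type, by adding one summand at a time. By \<open>abs_add_powr_le\<close> a new
  summand contributes a constant plus its variance times \<open>E |S|^(r - 2)\<close>, and the latter is controlled
  by the second moment of \<open>S\<close> because \<open>r - 2 \<le> 2\<close>. The parameter \<open>N\<close> bounds the number of summands
  and stays fixed during the induction, so that the bound is linear in \<open>card J\<close>; for \<open>card J = N\<close> it is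
  of order \<open>N^(r/2)\<close>.
\<close>

lemma (in prob_space) centred_sum_moment_bound:
  fixes X :: "'i \<Rightarrow> 'a \<Rightarrow> real" and r D m :: real and N :: nat
  assumes r: "2 < r" "r \<le> 3" and N: "card J \<le> N" "0 < N"
    and "finite J" "indep_vars (\<lambda>_. borel) X J"
    and "\<And>i. i \<in> J \<Longrightarrow> integrable M (X i)" "\<And>i. i \<in> J \<Longrightarrow> expectation (X i) = 0"
    and "\<And>i. i \<in> J \<Longrightarrow> integrable M (\<lambda>\<omega>. (X i \<omega>)\<^sup>2)"
    and "\<And>i. i \<in> J \<Longrightarrow> expectation (\<lambda>\<omega>. (X i \<omega>)\<^sup>2) \<le> D"
    and "\<And>i. i \<in> J \<Longrightarrow> integrable M (\<lambda>\<omega>. \<bar>X i \<omega>\<bar> powr r)"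
    and "\<And>i. i \<in> J \<Longrightarrow> expectation (\<lambda>\<omega>. \<bar>X i \<omega>\<bar> powr r) \<le> m"
    and D: "0 \<le> D"
  shows "integrable M (\<lambda>\<omega>. \<bar>\<Sum>i\<in>J. X i \<omega>\<bar> powr r) \<and>
    expectation (\<lambda>\<omega>. \<bar>\<Sum>i\<in>J. X i \<omega>\<bar> powr r) \<le>
      card J * (60 * (real N powr (r / 2 - 1) * (1 + D) * D + m))"
  using \<open>finite J\<close> assms(6-12) N(1)
proof (induction J rule: finite_induct)
  case (insert i J)
  let ?S = "\<lambda>\<omega>. \<Sum>i\<in>J. X i \<omega>"
  define K where "K = real N powr (r / 2 - 1)"
  have K0: "K \<ge> 0" by (simp add: K_def)
  have cJ: "card J < N" using insert by simp
  have indJ: "indep_vars (\<lambda>_. borel) X J"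
    by (rule indep_vars_subset[OF insert.prems(1)]) auto
  then have IH: "integrable M (\<lambda>\<omega>. \<bar>?S \<omega>\<bar> powr r)"
    "expectation (\<lambda>\<omega>. \<bar>?S \<omega>\<bar> powr r) \<le> card J * (60 * (K * (1 + D) * D + m))"
    using insert by (auto simp: K_def)
  have S2: "integrable M (\<lambda>\<omega>. (?S \<omega>)\<^sup>2)"
    "expectation (\<lambda>\<omega>. (?S \<omega>)\<^sup>2) = (\<Sum>i\<in>J. expectation (\<lambda>\<omega>. (X i \<omega>)\<^sup>2))"
    using centred_sum_second_moment[OF insert.hyps(1) indJ] insert.prems by auto
  have "(\<Sum>i\<in>J. expectation (\<lambda>\<omega>. (X i \<omega>)\<^sup>2)) \<le> card J * D"
    using insert.prems(5) by (intro sum_bounded_above) auto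
  also have "\<dots> \<le> N * D" using cJ D by (intro mult_right_mono) auto
  finally have S2': "expectation (\<lambda>\<omega>. (?S \<omega>)\<^sup>2) \<le> N * D" using S2 by simp
  have X: "integrable M (X i)" "expectation (X i) = 0" "integrable M (\<lambda>\<omega>. (X i \<omega>)\<^sup>2)"
    "expectation (\<lambda>\<omega>. (X i \<omega>)\<^sup>2) \<le> D" "integrable M (\<lambda>\<omega>. \<bar>X i \<omega>\<bar> powr r)"
    "expectation (\<lambda>\<omega>. \<bar>X i \<omega>\<bar> powr r) \<le> m"
    using insert.prems by auto
  have [measurable]: "X i \<in> borel_measurable M" "?S \<in> borel_measurable M"
    using insert.prems(1) by (auto intro!: borel_measurable_sum indep_vars_measurable)
  have ind: "indep_var borel (X i) borel ?S"
    using insert by (intro indep_vars_sum) auto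
  have Sint: "integrable M (\<lambda>\<omega>. \<bar>?S \<omega>\<bar> powr (r - 1))" "integrable M (\<lambda>\<omega>. \<bar>?S \<omega>\<bar> powr (r - 2))"
    using integrable_abs_powr_smaller[OF _ IH(1)] r by auto
  \<comment> \<open>In units of \<open>sqrt N\<close>, the typical size of the sum, \<open>u^(r - 2) \<le> 1 + u\<^sup>2\<close> loses only a constant.\<close>
  have "expectation (\<lambda>\<omega>. \<bar>?S \<omega>\<bar> powr (r - 2)) \<le> expectation (\<lambda>\<omega>. K * (1 + (?S \<omega>)\<^sup>2 / N))"
  proof (rule integral_mono[OF Sint(2)])
    show "integrable M (\<lambda>\<omega>. K * (1 + (?S \<omega>)\<^sup>2 / N))" using S2(1) by simp
    fix \<omega>
    define u where "u = \<bar>?S \<omega>\<bar> / sqrt N"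
    have u: "u \<ge> 0" by (simp add: u_def)
    have S: "\<bar>?S \<omega>\<bar> = sqrt N * u" using N by (simp add: u_def)
    have "\<bar>?S \<omega>\<bar> powr (r - 2) = sqrt N powr (r - 2) * u powr (r - 2)"
      unfolding S using u by (simp add: powr_mult)
    also have "sqrt N powr (r - 2) = K"
      using N by (simp add: K_def powr_powr flip: powr_half_sqrt) (simp add: diff_divide_distrib)
    also have "u powr (r - 2) \<le> 1 + u\<^sup>2"
    proof (cases "u \<le> 1")
      case True
      then have "u powr (r - 2) \<le> 1" using u r by (intro powr_le1) auto
      then show ?thesis using zero_le_power2[of u] by linarith
    next
      case False
      then have "u powr (r - 2) \<le> u powr 2" using r by (intro powr_mono) auto
      then show ?thesis using False by simp
    qed
    then have "K * u powr (r - 2) \<le> K * (1 + u\<^sup>2)" using K0 by (intro mult_left_mono)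
    also have "u\<^sup>2 = (?S \<omega>)\<^sup>2 / N" by (simp add: u_def power_divide)
    finally show "\<bar>?S \<omega>\<bar> powr (r - 2) \<le> K * (1 + (?S \<omega>)\<^sup>2 / N)" by simp
  qed
  also have "\<dots> = K * (1 + expectation (\<lambda>\<omega>. (?S \<omega>)\<^sup>2) / N)"
    using S2(1) by (simp add: prob_space)
  also have "\<dots> \<le> K * (1 + D)"
    using S2' N K0 by (intro mult_left_mono add_left_mono) (auto simp: field_simps)
  finally have ESr2: "expectation (\<lambda>\<omega>. \<bar>?S \<omega>\<bar> powr (r - 2)) \<le> K * (1 + D)" .
  let ?s = "\<lambda>\<omega>. sgn (?S \<omega>) * \<bar>?S \<omega>\<bar> powr (r - 1)"
  have sint: "integrable M ?s"
    by (rule Bochner_Integration.integrable_bound[OF Sint(1)]) (auto simp: abs_mult abs_sgn_eq)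
  have ind1: "indep_var borel (X i) borel ?s"
    using indep_var_compose[OF ind, of "\<lambda>x. x" borel "\<lambda>s. sgn s * \<bar>s\<bar> powr (r - 1)" borel]
    by (simp add: comp_def)
  have ind2: "indep_var borel (\<lambda>\<omega>. (X i \<omega>)\<^sup>2) borel (\<lambda>\<omega>. \<bar>?S \<omega>\<bar> powr (r - 2))"
    using indep_var_compose[OF ind, of "\<lambda>x. x\<^sup>2" borel "\<lambda>s. \<bar>s\<bar> powr (r - 2)" borel]
    by (simp add: comp_def)
  have P1: "integrable M (\<lambda>\<omega>. ?s \<omega> * X i \<omega>)" "expectation (\<lambda>\<omega>. ?s \<omega> * X i \<omega>) = 0"
    using indep_var_integrable[OF ind1 X(1) sint] indep_var_lebesgue_integral[OF ind1 X(1) sint] X(2)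
    by (auto simp: mult.commute)
  have P2: "integrable M (\<lambda>\<omega>. \<bar>?S \<omega>\<bar> powr (r - 2) * (X i \<omega>)\<^sup>2)"
    "expectation (\<lambda>\<omega>. \<bar>?S \<omega>\<bar> powr (r - 2) * (X i \<omega>)\<^sup>2) \<le> K * (1 + D) * D"
    using indep_var_integrable[OF ind2 X(3) Sint(2)]
      indep_var_lebesgue_integral[OF ind2 X(3) Sint(2)] ESr2 X(4) K0 D
      mult_mono[OF ESr2 X(4)]
    by (auto simp: mult.commute)
  let ?B = "\<lambda>\<omega>. \<bar>?S \<omega>\<bar> powr r + r * (?s \<omega> * X i \<omega>) +
    60 * (\<bar>?S \<omega>\<bar> powr (r - 2) * (X i \<omega>)\<^sup>2 + \<bar>X i \<omega>\<bar> powr r)"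
  have le: "\<bar>?S \<omega> + X i \<omega>\<bar> powr r \<le> ?B \<omega>" for \<omega>
    using abs_add_powr_le[OF r, of "?S \<omega>" "X i \<omega>"] by (simp add: mult_ac)
  have Bint: "integrable M ?B"
    using IH(1) P1(1) P2(1) X(5) by (intro Bochner_Integration.integrable_add integrable_mult_right)
  have int: "integrable M (\<lambda>\<omega>. \<bar>?S \<omega> + X i \<omega>\<bar> powr r)"
    by (rule Bochner_Integration.integrable_bound[OF Bint])
       (simp, rule AE_I2, simp only: real_norm_def abs_of_nonneg[OF powr_ge_zero],
        rule order_trans[OF le abs_ge_self])
  have "expectation (\<lambda>\<omega>. \<bar>?S \<omega> + X i \<omega>\<bar> powr r) \<le> expectation ?B"
    by (intro integral_mono int Bint le)
  also have "\<dots> = expectation (\<lambda>\<omega>. \<bar>?S \<omega>\<bar> powr r) +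
    60 * (expectation (\<lambda>\<omega>. \<bar>?S \<omega>\<bar> powr (r - 2) * (X i \<omega>)\<^sup>2) + expectation (\<lambda>\<omega>. \<bar>X i \<omega>\<bar> powr r))"
    using IH(1) P1 P2(1) X(5) by simp
  also have "\<dots> \<le> card J * (60 * (K * (1 + D) * D + m)) + 60 * (K * (1 + D) * D + m)"
    using IH(2) P2(2) X(6) by (intro add_mono mult_left_mono) auto
  also have "\<dots> = card (insert i J) * (60 * (K * (1 + D) * D + m))"
    using insert.hyps by (simp add: algebra_simps)
  finally show ?case
    using int insert.hyps by (simp add: K_def add.commute)
qed (use assms(1) in simp)

section \<open>One generation of the process\<close>

lemma abs_add_powr_crude:
  fixes a b r :: real
  assumes "0 \<le> r" "r \<le> 3"
  shows "\<bar>a + b\<bar> powr r \<le> 8 * (\<bar>a\<bar> powr r + \<bar>b\<bar> powr r)"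
proof -
  define u where "u = max \<bar>a\<bar> \<bar>b\<bar>"
  have "\<bar>a + b\<bar> powr r \<le> (2 * u) powr r"
    using assms by (intro powr_mono2) (auto simp: u_def)
  also have "\<dots> = 2 powr r * u powr r" by (simp add: powr_mult u_def)
  also have "\<dots> \<le> 8 * u powr r"
    using powr_mono[of r 3 "2::real"] assms by (intro mult_right_mono) auto
  also have "u powr r \<le> \<bar>a\<bar> powr r + \<bar>b\<bar> powr r"
    by (auto simp: u_def max_def)
  finally show ?thesis by simp
qed

context gw_immigration
begin

lemma measurable_\<xi> [measurable]: "\<xi> k m \<in> measurable M (count_space UNIV)"
  using indep by (auto simp: indep_vars_def dest!: spec[of _ "Inl (k, m)"])

lemma measurable_I [measurable]: "I m \<in> measurable M (count_space UNIV)"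
  using indep by (auto simp: indep_vars_def dest!: spec[of _ "Inr m"])

lemma \<xi>_same_law:
  fixes g :: "nat \<Rightarrow> real"
  shows "integrable M (\<lambda>\<omega>. g (\<xi> k m \<omega>)) \<longleftrightarrow> integrable M (\<lambda>\<omega>. g (\<xi> 1 1 \<omega>))"
    and "expectation (\<lambda>\<omega>. g (\<xi> k m \<omega>)) = expectation (\<lambda>\<omega>. g (\<xi> 1 1 \<omega>))"
  using integrable_distr_eq[of "\<xi> k m" M "count_space UNIV" g]
    integrable_distr_eq[of "\<xi> 1 1" M "count_space UNIV" g]
    integral_distr[of "\<xi> k m" M "count_space UNIV" g]
    integral_distr[of "\<xi> 1 1" M "count_space UNIV" g] \<xi>_identically_distributed[of k m]
  by simp_all

lemma I_same_law:
  fixes g :: "nat \<Rightarrow> real"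
  shows "integrable M (\<lambda>\<omega>. g (I m \<omega>)) \<longleftrightarrow> integrable M (\<lambda>\<omega>. g (I 1 \<omega>))"
    and "expectation (\<lambda>\<omega>. g (I m \<omega>)) = expectation (\<lambda>\<omega>. g (I 1 \<omega>))"
  using integrable_distr_eq[of "I m" M "count_space UNIV" g]
    integrable_distr_eq[of "I 1" M "count_space UNIV" g]
    integral_distr[of "I m" M "count_space UNIV" g]
    integral_distr[of "I 1" M "count_space UNIV" g] I_identically_distributed[of m]
  by simp_all

definition next_gen :: "nat \<Rightarrow> nat \<Rightarrow> 'a \<Rightarrow> nat" where
  "next_gen m x \<omega> = (\<Sum>k=1..x. \<xi> k m \<omega>) + I m \<omega>"

lemma measurable_next_gen [measurable]: "next_gen m x \<in> measurable M (count_space UNIV)"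
  unfolding next_gen_def by measurable

end

text \<open>
  The moment order \<open>r\<close> is capped at three, which loses nothing on a probability space and lets
  third-order Taylor remainders be absorbed.
\<close>

locale critical_gw_immigration = gw_immigration M \<xi> I
  for M :: "'a measure" and \<xi> I +
  fixes c d r :: real
  assumes r: "2 < r" "r \<le> 3"
    and \<xi>_int: "integrable M (\<lambda>\<omega>. real (\<xi> 1 1 \<omega>))"
    and \<xi>_mean: "expectation (\<lambda>\<omega>. real (\<xi> 1 1 \<omega>)) = 1"
    and \<xi>_var: "expectation (\<lambda>\<omega>. (real (\<xi> 1 1 \<omega>) - 1)\<^sup>2) = d"
    and \<xi>_moment: "integrable M (\<lambda>\<omega>. real (\<xi> 1 1 \<omega>) powr r)"
    and I_int: "integrable M (\<lambda>\<omega>. real (I 1 \<omega>))"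
    and I_mean: "expectation (\<lambda>\<omega>. real (I 1 \<omega>)) = c"
    and I_moment: "integrable M (\<lambda>\<omega>. real (I 1 \<omega>) powr r)"
    and d_pos: "0 < d" and c_pos: "0 < c" and c_less: "2 * c < d"
begin

text \<open>
  Offspring and immigration are centred and put into one family, over the index type of the joint
  independence assumption, so that the moment bound for independent sums applies to a whole
  generation at once.
\<close>

definition noise :: "(nat \<times> nat) + nat \<Rightarrow> 'a \<Rightarrow> real" where
  "noise i \<omega> = (case i of Inl (k, m) \<Rightarrow> real (\<xi> k m \<omega>) - 1 | Inr m \<Rightarrow> real (I m \<omega>) - c)"

definition noise_index :: "nat \<Rightarrow> nat \<Rightarrow> ((nat \<times> nat) + nat) set" where
  "noise_index m x = insert (Inr m) ((\<lambda>k. Inl (k, m)) ` {1..x})"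

lemma noise_simps [simp]:
  "noise (Inl (k, m)) \<omega> = real (\<xi> k m \<omega>) - 1" "noise (Inr m) \<omega> = real (I m \<omega>) - c"
  by (simp_all add: noise_def)

lemma indep_noise: "indep_vars (\<lambda>_. borel) noise UNIV"
proof -
  have "indep_vars (\<lambda>_. borel)
    (\<lambda>i \<omega>. real (case_sum (\<lambda>(k, n). \<xi> k n) I i \<omega>) - (case i of Inl _ \<Rightarrow> 1 | Inr _ \<Rightarrow> c)) UNIV"
    by (rule indep_vars_compose2[OF indep]) auto
  also have "(\<lambda>i \<omega>. real (case_sum (\<lambda>(k, n). \<xi> k n) I i \<omega>) - (case i of Inl _ \<Rightarrow> 1 | Inr _ \<Rightarrow> c)) = noise"
    by (auto simp: noise_def fun_eq_iff split: sum.splits)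
  finally show ?thesis .
qed

lemma next_gen_eq_noise:
  "real (next_gen m x \<omega>) = real x + c + (\<Sum>i\<in>noise_index m x. noise i \<omega>)"
proof -
  have "(\<Sum>i\<in>noise_index m x. noise i \<omega>) = real (I m \<omega>) - c + (\<Sum>k=1..x. real (\<xi> k m \<omega>) - 1)"
    unfolding noise_index_def
    by (subst sum.insert) (auto simp: sum.reindex inj_on_def)
  then show ?thesis by (simp add: next_gen_def sum_subtractf)
qed

lemma noise_moments:
  obtains D m where "0 \<le> D" "0 \<le> m"
    "\<And>i. integrable M (noise i)" "\<And>i. expectation (noise i) = 0"
    "\<And>i. integrable M (\<lambda>\<omega>. (noise i \<omega>)\<^sup>2)" "\<And>i. expectation (\<lambda>\<omega>. (noise i \<omega>)\<^sup>2) \<le> D"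
    "\<And>i. integrable M (\<lambda>\<omega>. \<bar>noise i \<omega>\<bar> powr r)" "\<And>i. expectation (\<lambda>\<omega>. \<bar>noise i \<omega>\<bar> powr r) \<le> m"
    "\<And>k l. expectation (\<lambda>\<omega>. (noise (Inl (k, l)) \<omega>)\<^sup>2) = d"
    "\<And>l. expectation (\<lambda>\<omega>. (noise (Inr l) \<omega>)\<^sup>2) = expectation (\<lambda>\<omega>. (noise (Inr 1) \<omega>)\<^sup>2)"
proof
  let ?v = "expectation (\<lambda>\<omega>. (noise (Inr 1) \<omega>)\<^sup>2)"
  let ?m = "\<lambda>i. expectation (\<lambda>\<omega>. \<bar>noise i \<omega>\<bar> powr r)"
  show v0: "0 \<le> d + ?v" using d_pos by (simp add: integral_nonneg)
  show m0: "0 \<le> ?m (Inl (1, 1)) + ?m (Inr 1)" by (simp add: integral_nonneg)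
  have \<xi>: "integrable M (\<lambda>\<omega>. \<bar>real (\<xi> 1 1 \<omega>) - 1\<bar> powr r)"
  proof (rule Bochner_Integration.integrable_bound)
    show "integrable M (\<lambda>\<omega>. 8 * (real (\<xi> 1 1 \<omega>) powr r + 1))" using \<xi>_moment by simp
    show "AE \<omega> in M. norm (\<bar>real (\<xi> 1 1 \<omega>) - 1\<bar> powr r) \<le> norm (8 * (real (\<xi> 1 1 \<omega>) powr r + 1))"
      using abs_add_powr_crude[of r "real (\<xi> 1 1 _)" "-1"] r by (intro AE_I2) simp
  qed simp
  have I: "integrable M (\<lambda>\<omega>. \<bar>real (I 1 \<omega>) - c\<bar> powr r)"
  proof (rule Bochner_Integration.integrable_bound)
    show "integrable M (\<lambda>\<omega>. 8 * (real (I 1 \<omega>) powr r + \<bar>c\<bar> powr r))" using I_moment by simp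
    show "AE \<omega> in M. norm (\<bar>real (I 1 \<omega>) - c\<bar> powr r) \<le> norm (8 * (real (I 1 \<omega>) powr r + \<bar>c\<bar> powr r))"
      using abs_add_powr_crude[of r "real (I 1 _)" "-c"] r by (intro AE_I2) simp
  qed simp
  fix i :: "(nat \<times> nat) + nat"
  show intr: "integrable M (\<lambda>\<omega>. \<bar>noise i \<omega>\<bar> powr r)"
    using \<xi> \<xi>_same_law(1)[of "\<lambda>n. \<bar>real n - 1\<bar> powr r"] I I_same_law(1)[of "\<lambda>n. \<bar>real n - c\<bar> powr r"]
    by (cases i) auto
  have [measurable]: "noise i \<in> borel_measurable M"
    using indep_noise by (intro indep_vars_measurable) auto
  have "integrable M (\<lambda>\<omega>. \<bar>noise i \<omega>\<bar> powr 1)" "integrable M (\<lambda>\<omega>. \<bar>noise i \<omega>\<bar> powr 2)"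
    using integrable_abs_powr_smaller[OF _ intr, of 1] integrable_abs_powr_smaller[OF _ intr, of 2] r
    by auto
  then show "integrable M (noise i)" and "integrable M (\<lambda>\<omega>. (noise i \<omega>)\<^sup>2)"
    by (simp_all add: integrable_abs_iff)
  show "expectation (noise i) = 0"
  proof (cases i)
    case (Inl p)
    obtain k l where p: "p = (k, l)" by (cases p)
    have "integrable M (\<lambda>\<omega>. real (\<xi> k l \<omega>))" "expectation (\<lambda>\<omega>. real (\<xi> k l \<omega>)) = 1"
      using \<xi>_int \<xi>_mean \<xi>_same_law[of real k l] by auto
    then show ?thesis by (simp add: Inl p noise_def[abs_def] prob_space)
  next
    case (Inr l)
    have "integrable M (\<lambda>\<omega>. real (I l \<omega>))" "expectation (\<lambda>\<omega>. real (I l \<omega>)) = c"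
      using I_int I_mean I_same_law[of real l] by auto
    then show ?thesis by (simp add: Inr noise_def[abs_def] prob_space)
  qed
  show vL: "expectation (\<lambda>\<omega>. (noise (Inl (k, l)) \<omega>)\<^sup>2) = d" for k l
    using \<xi>_var \<xi>_same_law(2)[of "\<lambda>n. (real n - 1)\<^sup>2" k l] by simp
  show vR: "expectation (\<lambda>\<omega>. (noise (Inr l) \<omega>)\<^sup>2) = ?v" for l
    using I_same_law(2)[of "\<lambda>n. (real n - c)\<^sup>2" l] by simp
  show "expectation (\<lambda>\<omega>. (noise i \<omega>)\<^sup>2) \<le> d + ?v"
  proof (cases i)
    case (Inl p)
    then show ?thesis using vL[of "fst p" "snd p"] by (simp add: integral_nonneg del: noise_simps)
  next
    case (Inr l)
    then show ?thesis using vR[of l] d_pos by (simp del: noise_simps)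
  qed
  have mL: "?m (Inl (k, l)) = ?m (Inl (1, 1))" for k l
    using \<xi>_same_law(2)[of "\<lambda>n. \<bar>real n - 1\<bar> powr r" k l] by simp
  have mR: "?m (Inr l) = ?m (Inr 1)" for l
    using I_same_law(2)[of "\<lambda>n. \<bar>real n - c\<bar> powr r" l] by simp
  show "?m i \<le> ?m (Inl (1, 1)) + ?m (Inr 1)"
  proof (cases i)
    case (Inl p)
    then show ?thesis using mL[of "fst p" "snd p"] by (simp add: integral_nonneg del: noise_simps)
  next
    case (Inr l)
    then show ?thesis using mR[of l] by (simp add: integral_nonneg del: noise_simps)
  qed
qed

lemma increment_moments:
  obtains v K where "0 \<le> v"
    "\<And>m x. integrable M (\<lambda>\<omega>. real (next_gen m x \<omega>))"
    "\<And>m x. expectation (\<lambda>\<omega>. real (next_gen m x \<omega>)) = x + c"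
    "\<And>m x. integrable M (\<lambda>\<omega>. (real (next_gen m x \<omega>) - x)\<^sup>2)"
    "\<And>m x. expectation (\<lambda>\<omega>. (real (next_gen m x \<omega>) - x)\<^sup>2) = x * d + v"
    "\<And>m x. integrable M (\<lambda>\<omega>. \<bar>real (next_gen m x \<omega>) - x\<bar> powr r)"
    "\<And>m x. 1 \<le> x \<Longrightarrow> expectation (\<lambda>\<omega>. \<bar>real (next_gen m x \<omega>) - x\<bar> powr r) \<le> K * x powr (r / 2)"
proof -
  obtain D b where Db: "0 \<le> D" "0 \<le> b" and
    n: "\<And>i. integrable M (noise i)" "\<And>i. expectation (noise i) = 0"
    "\<And>i. integrable M (\<lambda>\<omega>. (noise i \<omega>)\<^sup>2)" "\<And>i. expectation (\<lambda>\<omega>. (noise i \<omega>)\<^sup>2) \<le> D"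
    "\<And>i. integrable M (\<lambda>\<omega>. \<bar>noise i \<omega>\<bar> powr r)" "\<And>i. expectation (\<lambda>\<omega>. \<bar>noise i \<omega>\<bar> powr r) \<le> b"
    and vL: "\<And>k l. expectation (\<lambda>\<omega>. (noise (Inl (k, l)) \<omega>)\<^sup>2) = d"
    and vR: "\<And>l. expectation (\<lambda>\<omega>. (noise (Inr l) \<omega>)\<^sup>2) = expectation (\<lambda>\<omega>. (noise (Inr 1) \<omega>)\<^sup>2)"
    using noise_moments by blast
  define w where "w = expectation (\<lambda>\<omega>. (noise (Inr 1) \<omega>)\<^sup>2)"
  define Y where "Y m x \<omega> = (\<Sum>i\<in>noise_index m x. noise i \<omega>)" for m x \<omega>
  have fin: "finite (noise_index m x)" for m x by (simp add: noise_index_def)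
  have ind: "indep_vars (\<lambda>_. borel) noise (noise_index m x)" for m x
    by (rule indep_vars_subset[OF indep_noise]) auto
  have card: "card (noise_index m x) = x + 1" for m x
    unfolding noise_index_def by (subst card_insert_disjoint) (auto simp: card_image inj_on_def)
  have Y2: "integrable M (Y m x)" "expectation (Y m x) = 0" "integrable M (\<lambda>\<omega>. (Y m x \<omega>)\<^sup>2)"
    "expectation (\<lambda>\<omega>. (Y m x \<omega>)\<^sup>2) = (\<Sum>i\<in>noise_index m x. expectation (\<lambda>\<omega>. (noise i \<omega>)\<^sup>2))" for m x
    using centred_sum_second_moment[OF fin ind n(1) n(2) n(3), of m x]
    unfolding Y_def by (auto simp del: noise_simps)
  have "(\<Sum>i\<in>noise_index m x. expectation (\<lambda>\<omega>. (noise i \<omega>)\<^sup>2)) = w + x * d" for m x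
    unfolding noise_index_def w_def
    by (subst sum.insert) (auto simp: sum.reindex inj_on_def vL vR[of m] simp del: noise_simps)
  then have EY2: "expectation (\<lambda>\<omega>. (Y m x \<omega>)\<^sup>2) = w + x * d" for m x using Y2(4) by simp
  have next_eq: "real (next_gen m x \<omega>) = x + c + Y m x \<omega>" for m x \<omega>
    by (simp add: next_gen_eq_noise Y_def)
  have sq: "(real (next_gen m x \<omega>) - x)\<^sup>2 = (Y m x \<omega>)\<^sup>2 + 2 * c * Y m x \<omega> + c\<^sup>2" for m x \<omega>
    by (simp add: next_eq power2_eq_square algebra_simps)
  define E where "E = 60 * ((1 + D) * D + b)"
  have E0: "E \<ge> 0" using Db by (simp add: E_def)
  have Yr: "integrable M (\<lambda>\<omega>. \<bar>Y m x \<omega>\<bar> powr r)" and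
    EYr: "1 \<le> x \<Longrightarrow> expectation (\<lambda>\<omega>. \<bar>Y m x \<omega>\<bar> powr r) \<le> 4 * E * x powr (r / 2)" for m x
  proof -
    have *: "integrable M (\<lambda>\<omega>. \<bar>Y m x \<omega>\<bar> powr r)"
      "expectation (\<lambda>\<omega>. \<bar>Y m x \<omega>\<bar> powr r) \<le>
        real (x + 1) * (60 * (real (x + 1) powr (r / 2 - 1) * (1 + D) * D + b))"
      using centred_sum_moment_bound[OF r _ _ fin ind n Db(1), of m x "x + 1"]
      unfolding Y_def card by simp_all
    show "integrable M (\<lambda>\<omega>. \<bar>Y m x \<omega>\<bar> powr r)" by fact
    assume x: "1 \<le> x"
    have p1: "1 \<le> real (x + 1) powr (r / 2 - 1)"
      using r by (intro ge_one_powr_ge_zero) auto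
    have "60 * (real (x + 1) powr (r / 2 - 1) * (1 + D) * D + b) \<le> E * real (x + 1) powr (r / 2 - 1)"
      using mult_left_mono[OF p1 Db(2)] by (simp add: E_def algebra_simps)
    then have "real (x + 1) * (60 * (real (x + 1) powr (r / 2 - 1) * (1 + D) * D + b)) \<le>
        real (x + 1) * (E * real (x + 1) powr (r / 2 - 1))"
      by (intro mult_left_mono) auto
    also have "\<dots> = E * real (x + 1) powr (r / 2)"
      by (simp add: powr_diff)
    finally have 1: "real (x + 1) * (60 * (real (x + 1) powr (r / 2 - 1) * (1 + D) * D + b)) \<le>
        E * real (x + 1) powr (r / 2)" .
    have "real (x + 1) powr (r / 2) \<le> (2 * real x) powr (r / 2)"
      using x r by (intro powr_mono2) auto
    also have "\<dots> = 2 powr (r / 2) * x powr (r / 2)" by (simp add: powr_mult)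
    also have "\<dots> \<le> 4 * x powr (r / 2)"
      using powr_mono[of "r / 2" 2 "2::real"] r by (intro mult_right_mono) auto
    finally have "E * real (x + 1) powr (r / 2) \<le> E * (4 * x powr (r / 2))"
      using E0 by (rule mult_left_mono)
    with *(2) 1 have "expectation (\<lambda>\<omega>. \<bar>Y m x \<omega>\<bar> powr r) \<le> E * (4 * x powr (r / 2))"
      by linarith
    then show "expectation (\<lambda>\<omega>. \<bar>Y m x \<omega>\<bar> powr r) \<le> 4 * E * x powr (r / 2)"
      by (simp add: mult_ac)
  qed
  have le: "\<bar>real (next_gen m x \<omega>) - x\<bar> powr r \<le> 8 * (\<bar>Y m x \<omega>\<bar> powr r + c powr r)" for m x \<omega>
    using abs_add_powr_crude[of r "Y m x \<omega>" c] r c_pos by (simp add: next_eq add.commute)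
  have intr: "integrable M (\<lambda>\<omega>. \<bar>real (next_gen m x \<omega>) - x\<bar> powr r)" for m x
    by (rule Bochner_Integration.integrable_bound[of M "\<lambda>\<omega>. 8 * (\<bar>Y m x \<omega>\<bar> powr r + c powr r)"])
       (use Yr le in \<open>auto simp: abs_of_nonneg\<close>)
  show thesis
  proof (rule that[of "w + c\<^sup>2" "8 * (4 * E + c powr r)"])
    show "0 \<le> w + c\<^sup>2" by (simp add: w_def integral_nonneg)
    fix m x
    show "integrable M (\<lambda>\<omega>. real (next_gen m x \<omega>))" "expectation (\<lambda>\<omega>. real (next_gen m x \<omega>)) = x + c"
      using Y2(1,2)[of m x] by (simp_all add: next_eq prob_space)
    show "integrable M (\<lambda>\<omega>. (real (next_gen m x \<omega>) - x)\<^sup>2)"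
      "expectation (\<lambda>\<omega>. (real (next_gen m x \<omega>) - x)\<^sup>2) = x * d + (w + c\<^sup>2)"
      using Y2(1-3)[of m x] EY2[of m x] unfolding sq by (simp_all add: prob_space)
    show "integrable M (\<lambda>\<omega>. \<bar>real (next_gen m x \<omega>) - x\<bar> powr r)" by fact
    assume x: "1 \<le> x"
    have "expectation (\<lambda>\<omega>. \<bar>real (next_gen m x \<omega>) - x\<bar> powr r) \<le>
        expectation (\<lambda>\<omega>. 8 * (\<bar>Y m x \<omega>\<bar> powr r + c powr r))"
      using Yr by (intro integral_mono intr le) auto
    also have "\<dots> = 8 * (expectation (\<lambda>\<omega>. \<bar>Y m x \<omega>\<bar> powr r) + c powr r)"
      using Yr by (simp add: prob_space)
    also have "\<dots> \<le> 8 * (4 * E * x powr (r / 2) + c powr r * x powr (r / 2))"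
      using EYr[OF x] mult_left_mono[OF ge_one_powr_ge_zero[of x "r/2"], of "c powr r"] x r
      by (intro mult_left_mono add_mono) auto
    finally show "expectation (\<lambda>\<omega>. \<bar>real (next_gen m x \<omega>) - x\<bar> powr r) \<le>
        8 * (4 * E + c powr r) * x powr (r / 2)"
      by (simp add: algebra_simps)
  qed
qed

text \<open>
  Expand \<open>x^q (1 + t)^q\<close> with \<open>t = (X' - x) / x\<close>. The mean and the variance of the increment produce the
  main terms. The remainder is at most a multiple of \<open>x^q E |t|^r\<close>, that is of \<open>x^(q - r/2)\<close>, which is
  of smaller order than \<open>x^(q - 1)\<close> because \<open>r > 2\<close>.
\<close>

lemma powr_drift:
  assumes q: "0 < q" "q < 1"
  obtains C where
    "\<And>m x. integrable M (\<lambda>\<omega>. real (next_gen m x \<omega>) powr q)"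
    "\<And>m x. 1 \<le> x \<Longrightarrow> \<bar>expectation (\<lambda>\<omega>. real (next_gen m x \<omega>) powr q) -
       (x powr q + q * (c - (1 - q) * d / 2) * x powr (q - 1))\<bar> \<le> C * x powr (q - r / 2)"
proof -
  obtain v K where v: "0 \<le> v" and
    N: "\<And>m x. integrable M (\<lambda>\<omega>. real (next_gen m x \<omega>))"
    "\<And>m x. expectation (\<lambda>\<omega>. real (next_gen m x \<omega>)) = x + c"
    "\<And>m x. integrable M (\<lambda>\<omega>. (real (next_gen m x \<omega>) - x)\<^sup>2)"
    "\<And>m x. expectation (\<lambda>\<omega>. (real (next_gen m x \<omega>) - x)\<^sup>2) = x * d + v"
    "\<And>m x. integrable M (\<lambda>\<omega>. \<bar>real (next_gen m x \<omega>) - x\<bar> powr r)"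
    "\<And>m x. 1 \<le> x \<Longrightarrow> expectation (\<lambda>\<omega>. \<bar>real (next_gen m x \<omega>) - x\<bar> powr r) \<le> K * x powr (r / 2)"
    using increment_moments by blast
  have int: "integrable M (\<lambda>\<omega>. real (next_gen m x \<omega>) powr q)" for m x
    using integrable_abs_powr_smaller[of "\<lambda>\<omega>. real (next_gen m x \<omega>)" 1 q] N(1)[of m x] q by simp
  show thesis
  proof (rule that[of "50 * K + v", OF int])
    fix m x :: nat assume x: "1 \<le> x"
    define t where "t \<omega> = (real (next_gen m x \<omega>) - x) / x" for \<omega>
    have t: "-1 \<le> t \<omega>" "real (next_gen m x \<omega>) = x * (1 + t \<omega>)" for \<omega>
      using x by (auto simp: t_def field_simps)
    let ?T = "\<lambda>\<omega>. 1 + q * t \<omega> + q * (q - 1) / 2 * (t \<omega>)\<^sup>2"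
    have t_int: "integrable M t" "integrable M (\<lambda>\<omega>. (t \<omega>)\<^sup>2)" "integrable M (\<lambda>\<omega>. \<bar>t \<omega>\<bar> powr r)"
      using N(1)[of m x] N(3)[of m x] N(5)[of m x] x
      unfolding t_def by (simp_all add: power_divide powr_divide)
    have Et: "expectation t = c / x" "expectation (\<lambda>\<omega>. (t \<omega>)\<^sup>2) = (x * d + v) / x\<^sup>2"
      using N(1-4)[of m x] unfolding t_def by (simp_all add: power_divide prob_space)
    have Etr: "expectation (\<lambda>\<omega>. \<bar>t \<omega>\<bar> powr r) \<le> K * x powr (- r / 2)"
    proof -
      have "expectation (\<lambda>\<omega>. \<bar>t \<omega>\<bar> powr r) =
          expectation (\<lambda>\<omega>. \<bar>real (next_gen m x \<omega>) - x\<bar> powr r) / x powr r"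
        unfolding t_def by (simp add: powr_divide)
      also have "\<dots> \<le> K * x powr (r / 2) / x powr r"
        using N(6)[OF x] by (intro divide_right_mono) auto
      also have "\<dots> = K * x powr (- r / 2)"
        using powr_diff[of x "r / 2" r] by simp
      finally show ?thesis .
    qed
    have bd: "\<bar>real (next_gen m x \<omega>) powr q - x powr q * ?T \<omega>\<bar> \<le> x powr q * (50 * \<bar>t \<omega>\<bar> powr r)" for \<omega>
    proof -
      have "real (next_gen m x \<omega>) powr q - x powr q * ?T \<omega> =
          x powr q * ((1 + t \<omega>) powr q - 1 - q * t \<omega> - q * (q - 1) / 2 * (t \<omega>)\<^sup>2)"
        unfolding t(2) powr_mult by (simp add: algebra_simps)
      then show ?thesis
        using concave_powr_expansion[OF q r t(1)] by (simp add: abs_mult mult_left_mono)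
    qed
    have T_int: "integrable M (\<lambda>\<omega>. x powr q * ?T \<omega>)" using t_int by simp
    have ET: "expectation (\<lambda>\<omega>. x powr q * ?T \<omega>) =
        x powr q * (1 + q * (c / x) + q * (q - 1) / 2 * ((x * d + v) / x\<^sup>2))"
      using t_int by (simp add: Et prob_space)
    have "\<bar>expectation (\<lambda>\<omega>. real (next_gen m x \<omega>) powr q) - expectation (\<lambda>\<omega>. x powr q * ?T \<omega>)\<bar> =
        \<bar>expectation (\<lambda>\<omega>. real (next_gen m x \<omega>) powr q - x powr q * ?T \<omega>)\<bar>"
      using int T_int by simp
    also have "\<dots> \<le> expectation (\<lambda>\<omega>. \<bar>real (next_gen m x \<omega>) powr q - x powr q * ?T \<omega>\<bar>)"
      by (rule integral_abs_bound)
    also have "\<dots> \<le> expectation (\<lambda>\<omega>. x powr q * (50 * \<bar>t \<omega>\<bar> powr r))"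
      using int T_int t_int by (intro integral_mono bd) auto
    also have "\<dots> = x powr q * (50 * expectation (\<lambda>\<omega>. \<bar>t \<omega>\<bar> powr r))"
      using t_int by simp
    also have "\<dots> \<le> x powr q * (50 * (K * x powr (- r / 2)))"
      using Etr by (intro mult_left_mono) auto
    also have "\<dots> = 50 * K * x powr (q - r / 2)"
      using powr_add[of x q "- r / 2"] by simp
    finally have 1: "\<bar>expectation (\<lambda>\<omega>. real (next_gen m x \<omega>) powr q) -
        expectation (\<lambda>\<omega>. x powr q * ?T \<omega>)\<bar> \<le> 50 * K * x powr (q - r / 2)" .
    have 2: "expectation (\<lambda>\<omega>. x powr q * ?T \<omega>) -
        (x powr q + q * (c - (1 - q) * d / 2) * x powr (q - 1)) = - (q * (1 - q) / 2 * v * x powr (q - 2))"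
      unfolding ET using x by (simp add: powr_diff powr_numeral field_simps power2_eq_square)
    have "q * (1 - q) \<le> 1 * 1" using q by (intro mult_mono) auto
    then have "q * (1 - q) / 2 * v * x powr (q - 2) \<le> 1 * v * x powr (q - r / 2)"
      using v x r q by (intro mult_mono powr_mono) auto
    moreover have "0 \<le> q * (1 - q) / 2 * v * x powr (q - 2)" using q v by simp
    ultimately show "\<bar>expectation (\<lambda>\<omega>. real (next_gen m x \<omega>) powr q) -
       (x powr q + q * (c - (1 - q) * d / 2) * x powr (q - 1))\<bar> \<le> (50 * K + v) * x powr (q - r / 2)"
      using 1 2 unfolding abs_le_iff distrib_right by linarith
  qed
qed

end

section \<open>The Markov property of the killed process\<close>

lemma (in prob_space) indep_var_nn_integral:
  fixes f g :: "'a \<Rightarrow> ennreal"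
  assumes "indep_var borel f borel g"
  shows "(\<integral>\<^sup>+\<omega>. f \<omega> * g \<omega> \<partial>M) = (\<integral>\<^sup>+\<omega>. f \<omega> \<partial>M) * (\<integral>\<^sup>+\<omega>. g \<omega> \<partial>M)"
proof -
  have borel: "case_bool borel borel = (\<lambda>_. borel)"
    by (auto simp: fun_eq_iff split: bool.splits)
  have "indep_vars (\<lambda>_. borel) (case_bool f g) UNIV"
    using assms unfolding indep_var_def borel .
  from indep_vars_nn_integral[OF _ this] show ?thesis
    by (simp add: UNIV_bool mult.commute)
qed

lemma hitting_time_gt_iff: "hitting_time A X > enat n \<longleftrightarrow> (\<forall>j\<le>n. real (X j) > A)"
proof
  assume h: "hitting_time A X > enat n"
  show "\<forall>j\<le>n. real (X j) > A"
  proof (intro allI impI, rule ccontr)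
    fix j assume "j \<le> n" "\<not> A < real (X j)"
    then have "hitting_time A X \<le> enat j" unfolding hitting_time_def by (intro Inf_lower) auto
    with h \<open>j \<le> n\<close> show False by (metis enat_ord_simps(1) leD order_trans)
  qed
next
  assume h: "\<forall>j\<le>n. real (X j) > A"
  have "enat (Suc n) \<le> hitting_time A X"
    unfolding hitting_time_def
  proof (rule Inf_greatest, clarify)
    fix j assume "real (X j) \<le> A"
    then have "\<not> j \<le> n" using h by force
    then show "enat (Suc n) \<le> enat j" by simp
  qed
  then show "hitting_time A X > enat n" by (metis Suc_ile_eq)
qed

lemma measurable_random_sum:
  fixes f :: "nat \<Rightarrow> 'b \<Rightarrow> nat" and g h :: "'b \<Rightarrow> nat"
  assumes f [measurable]: "\<And>k. f k \<in> measurable N (count_space UNIV)"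
    and g: "g \<in> measurable N (count_space UNIV)"
    and h [measurable]: "h \<in> measurable N (count_space UNIV)"
  shows "(\<lambda>w. (\<Sum>k=1..g w. f k w) + h w) \<in> measurable N (count_space UNIV)"
  by (rule measurable_compose_countable[OF _ g, of "\<lambda>i w. (\<Sum>k=1..i. f k w) + h w"]) measurable

context gw_immigration
begin

lemma measurable_gw_process [measurable]:
  "gw_process \<xi> I x0 n \<in> measurable M (count_space UNIV)"
proof (induction n)
  case (Suc n)
  note Suc [measurable]
  have "(\<lambda>\<omega>. next_gen n (gw_process \<xi> I x0 n \<omega>) \<omega>) \<in> measurable M (count_space UNIV)"
    by (rule measurable_compose_countable) measurable
  then show ?case by (simp add: next_gen_def)
qed simp

lemma gw_process_Suc: "gw_process \<xi> I x0 (Suc n) \<omega> = next_gen n (gw_process \<xi> I x0 n \<omega>) \<omega>"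
  by (simp add: next_gen_def)

text \<open>
  The allowed region may vary with time: the lower bound needs paths that climb at first and then
  stay high.
\<close>

definition stays_in :: "(nat \<Rightarrow> nat set) \<Rightarrow> nat \<Rightarrow> nat \<Rightarrow> 'a \<Rightarrow> bool" where
  "stays_in B x0 n \<omega> \<longleftrightarrow> (\<forall>j\<le>n. gw_process \<xi> I x0 j \<omega> \<in> B j)"

lemma stays_in_Suc:
  "stays_in B x0 (Suc n) \<omega> \<longleftrightarrow> stays_in B x0 n \<omega> \<and> gw_process \<xi> I x0 (Suc n) \<omega> \<in> B (Suc n)"
  by (auto simp: stays_in_def le_Suc_eq simp del: gw_process.simps)

lemma measurable_stays_in [measurable]: "Measurable.pred M (stays_in B x0 n)"
  unfolding stays_in_def by measurable

text \<open>
  The past is a function of the variables with time index below \<open>m\<close>, while the next generation uses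
  only those with time index \<open>m\<close>.
\<close>

lemma indep_past_next_gen:
  fixes f :: "nat \<Rightarrow> bool \<Rightarrow> ennreal" and h :: "nat \<Rightarrow> ennreal"
  shows "indep_var borel (\<lambda>\<omega>. f (gw_process \<xi> I x0 m \<omega>) (stays_in B x0 m \<omega>))
     borel (\<lambda>\<omega>. h (next_gen m y \<omega>))"
proof -
  define past :: "((nat \<times> nat) + nat) set" where "past = Inl ` {(k, j). j < m} \<union> Inr ` {..<m}"
  define now :: "((nat \<times> nat) + nat) set" where "now = insert (Inr m) (range (\<lambda>k. Inl (k, m)))"
  let ?F = "case_sum (\<lambda>(k, n). \<xi> k n) I"
  let ?gw = "gw_process (\<lambda>k j w. w (Inl (k, j))) (\<lambda>j w. w (Inr j)) x0"
  let ?PM = "PiM past (\<lambda>_. count_space (UNIV :: nat set))"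
  have meas: "?gw j \<in> measurable ?PM (count_space UNIV)" if "j \<le> m" for j
    using that
  proof (induction j)
    case (Suc j)
    then have "?gw j \<in> measurable ?PM (count_space UNIV)" by simp
    have c: "(\<lambda>w. w (Inl (k, j))) \<in> measurable ?PM (count_space UNIV)"
      "(\<lambda>w. w (Inr j)) \<in> measurable ?PM (count_space UNIV)" for k
      using Suc.prems by (auto intro!: measurable_component_singleton simp: past_def)
    have "(\<lambda>w. (\<Sum>k=1..?gw j w. w (Inl (k, j))) + w (Inr j)) \<in> measurable ?PM (count_space UNIV)"
      by (rule measurable_random_sum[of "\<lambda>k w. w (Inl (k, j))", OF c(1) _ c(2)]) fact
    then show ?case by simp
  next
    case 0
    have "?gw 0 = (\<lambda>_. x0)" by (simp add: fun_eq_iff)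
    then show ?case by simp
  qed
  \<comment> \<open>The recursion run on coordinates shows that \<open>gw_process\<close> factors through the restriction to \<open>past\<close>.\<close>
  have past_eq: "?gw j (restrict (\<lambda>i. ?F i \<omega>) past) = gw_process \<xi> I x0 j \<omega>" if "j \<le> m" for j \<omega>
    using that by (induction j) (auto simp: past_def)
  have "indep_var ?PM (\<lambda>\<omega>. restrict (\<lambda>i. ?F i \<omega>) past)
      (PiM now (\<lambda>_. count_space UNIV)) (\<lambda>\<omega>. restrict (\<lambda>i. ?F i \<omega>) now)"
    by (rule indep_var_restrict[OF indep]) (auto simp: past_def now_def)
  then have "indep_var borel
      ((\<lambda>w. f (?gw m w) (\<forall>j\<le>m. ?gw j w \<in> B j)) \<circ> (\<lambda>\<omega>. restrict (\<lambda>i. ?F i \<omega>) past))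
      borel
      ((\<lambda>w. h ((\<Sum>k=1..y. w (Inl (k, m))) + w (Inr m))) \<circ> (\<lambda>\<omega>. restrict (\<lambda>i. ?F i \<omega>) now))"
  proof (rule indep_var_compose)
    note [measurable] = meas
    have "Measurable.pred ?PM (\<lambda>w. \<forall>j\<in>{..m}. ?gw j w \<in> B j)"
      by measurable
    then have [measurable]: "Measurable.pred ?PM (\<lambda>w. \<forall>j\<le>m. ?gw j w \<in> B j)"
      by (simp add: Ball_def)
    have [measurable]: "?gw m \<in> measurable ?PM (count_space UNIV)" by (rule meas) simp
    show "(\<lambda>w. f (?gw m w) (\<forall>j\<le>m. ?gw j w \<in> B j)) \<in> borel_measurable ?PM"
      by measurable
    have comp: "(\<lambda>w. w i) \<in> measurable (PiM now (\<lambda>_. count_space UNIV)) (count_space UNIV)" if "i \<in> now" for i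
      using that by (rule measurable_component_singleton)
    have [measurable]: "(\<lambda>w. (\<Sum>k=1..y. w (Inl (k, m))) + w (Inr m)) \<in>
        measurable (PiM now (\<lambda>_. count_space (UNIV :: nat set))) (count_space UNIV)"
      by (rule measurable_random_sum[of "\<lambda>k w. w (Inl (k, m))"]) (simp_all add: comp now_def)
    show "(\<lambda>w. h ((\<Sum>k=1..y. w (Inl (k, m))) + w (Inr m))) \<in>
        borel_measurable (PiM now (\<lambda>_. count_space UNIV))"
      by measurable
  qed
  also have "(\<lambda>w. f (?gw m w) (\<forall>j\<le>m. ?gw j w \<in> B j)) \<circ> (\<lambda>\<omega>. restrict (\<lambda>i. ?F i \<omega>) past) =
      (\<lambda>\<omega>. f (gw_process \<xi> I x0 m \<omega>) (stays_in B x0 m \<omega>))"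
    by (auto simp: fun_eq_iff past_eq stays_in_def)
  also have "(\<lambda>w. h ((\<Sum>k=1..y. w (Inl (k, m))) + w (Inr m))) \<circ> (\<lambda>\<omega>. restrict (\<lambda>i. ?F i \<omega>) now) =
      (\<lambda>\<omega>. h (next_gen m y \<omega>))"
    by (auto simp: fun_eq_iff now_def next_gen_def)
  finally show ?thesis .
qed

text \<open>
  The action on \<open>g\<close> of the \<open>n\<close>-step kernel of the process killed on leaving \<open>B\<close>, and of one step of that
  kernel. Values in \<open>ennreal\<close> dispense with integrability conditions on \<open>g\<close>.
\<close>

definition killed :: "(nat \<Rightarrow> nat set) \<Rightarrow> nat \<Rightarrow> nat \<Rightarrow> (nat \<Rightarrow> ennreal) \<Rightarrow> ennreal" where
  "killed B x0 n g = (\<integral>\<^sup>+\<omega>. (if stays_in B x0 n \<omega> then g (gw_process \<xi> I x0 n \<omega>) else 0) \<partial>M)"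

definition killed_step :: "nat set \<Rightarrow> nat \<Rightarrow> (nat \<Rightarrow> ennreal) \<Rightarrow> nat \<Rightarrow> ennreal" where
  "killed_step S m g y = (\<integral>\<^sup>+\<omega>. (if next_gen m y \<omega> \<in> S then g (next_gen m y \<omega>) else 0) \<partial>M)"

text \<open>
  The Markov property. Splitting according to the countably many values of \<open>X_m\<close> reduces it to
  independence of the past and the next generation.
\<close>

lemma killed_Suc: "killed B x0 (Suc m) g = killed B x0 m (killed_step (B (Suc m)) m g)"
proof -
  let ?X = "gw_process \<xi> I x0 m"
  define h where "h z = (if z \<in> B (Suc m) then g z else 0)" for z
  let ?at = "\<lambda>y \<omega>. if ?X \<omega> = y \<and> stays_in B x0 m \<omega> then 1 else (0 :: ennreal)"
  let ?Q = "killed_step (B (Suc m)) m g"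
  have Q: "?Q y = (\<integral>\<^sup>+\<omega>. h (next_gen m y \<omega>) \<partial>M)" for y
    by (simp add: killed_step_def h_def)
  have split: "(if stays_in B x0 m \<omega> then f (?X \<omega>) else 0) = (\<Sum>y. ?at y \<omega> * f y)" 
    for f :: "nat \<Rightarrow> ennreal" and \<omega>
  proof -
    have "(\<lambda>y. if y = ?X \<omega> then (if stays_in B x0 m \<omega> then f y else 0) else 0) sums
        (if stays_in B x0 m \<omega> then f (?X \<omega>) else 0)"
      by (rule sums_single)
    also have "(\<lambda>y. if y = ?X \<omega> then (if stays_in B x0 m \<omega> then f y else 0) else 0) = (\<lambda>y. ?at y \<omega> * f y)"
      by auto
    finally show ?thesis by (rule sums_unique)
  qed
  have prod: "(\<integral>\<^sup>+\<omega>. ?at y \<omega> * h (next_gen m y \<omega>) \<partial>M) = (\<integral>\<^sup>+\<omega>. ?at y \<omega> * ?Q y \<partial>M)" for y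
  proof -
    have "indep_var borel (?at y) borel (\<lambda>\<omega>. h (next_gen m y \<omega>))"
      by (rule indep_past_next_gen[of "\<lambda>x s. if x = y \<and> s then 1 else 0"])
    from indep_var_nn_integral[OF this]
    have "(\<integral>\<^sup>+\<omega>. ?at y \<omega> * h (next_gen m y \<omega>) \<partial>M) = (\<integral>\<^sup>+\<omega>. ?at y \<omega> \<partial>M) * ?Q y"
      by (simp add: Q)
    also have "\<dots> = (\<integral>\<^sup>+\<omega>. ?at y \<omega> * ?Q y \<partial>M)"
      by (rule nn_integral_multc[symmetric]) measurable
    finally show ?thesis .
  qed
  have "killed B x0 (Suc m) g =
      (\<integral>\<^sup>+\<omega>. (if stays_in B x0 m \<omega> then h (next_gen m (?X \<omega>) \<omega>) else 0) \<partial>M)"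
    unfolding killed_def
    by (intro nn_integral_cong) (simp add: stays_in_Suc gw_process_Suc h_def del: gw_process.simps)
  also have "\<dots> = (\<integral>\<^sup>+\<omega>. (\<Sum>y. ?at y \<omega> * h (next_gen m y \<omega>)) \<partial>M)"
    by (intro nn_integral_cong split)
  also have "\<dots> = (\<Sum>y. \<integral>\<^sup>+\<omega>. ?at y \<omega> * h (next_gen m y \<omega>) \<partial>M)"
    by (rule nn_integral_suminf) measurable
  also have "\<dots> = (\<Sum>y. \<integral>\<^sup>+\<omega>. ?at y \<omega> * ?Q y \<partial>M)"
    by (simp only: prod)
  also have "\<dots> = (\<integral>\<^sup>+\<omega>. (\<Sum>y. ?at y \<omega> * ?Q y) \<partial>M)"
    by (rule nn_integral_suminf[symmetric]) measurable
  also have "\<dots> = killed B x0 m ?Q"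
    unfolding killed_def by (intro nn_integral_cong split[symmetric])
  finally show ?thesis .
qed

lemma killed_mono:
  assumes "\<And>x. x \<in> B n \<Longrightarrow> g x \<le> h x"
  shows "killed B x0 n g \<le> killed B x0 n h"
  unfolding killed_def using assms by (intro nn_integral_mono) (auto simp: stays_in_def)

lemma killed_subset:
  assumes "\<And>j. j \<le> n \<Longrightarrow> B j \<subseteq> B' j"
  shows "killed B x0 n g \<le> killed B' x0 n g"
  unfolding killed_def using assms by (intro nn_integral_mono) (auto simp: stays_in_def)

lemma killed_0: "x0 \<in> B 0 \<Longrightarrow> killed B x0 0 g = g x0"
  by (simp add: killed_def stays_in_def emeasure_space_1)

lemma killed_one: "killed B x0 n (\<lambda>_. 1) = ennreal (prob {\<omega> \<in> space M. stays_in B x0 n \<omega>})"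
proof -
  have "killed B x0 n (\<lambda>_. 1) = (\<integral>\<^sup>+\<omega>. indicator {\<omega> \<in> space M. stays_in B x0 n \<omega>} \<omega> \<partial>M)"
    unfolding killed_def by (intro nn_integral_cong) auto
  then show ?thesis by (simp add: emeasure_eq_measure)
qed

lemma killed_add: "killed B x0 n (\<lambda>x. g x + h x) = killed B x0 n g + killed B x0 n h"
proof -
  have "killed B x0 n (\<lambda>x. g x + h x) =
    (\<integral>\<^sup>+\<omega>. (if stays_in B x0 n \<omega> then g (gw_process \<xi> I x0 n \<omega>) else 0) +
      (if stays_in B x0 n \<omega> then h (gw_process \<xi> I x0 n \<omega>) else 0) \<partial>M)"
    unfolding killed_def by (intro nn_integral_cong) auto
  also have "\<dots> = killed B x0 n g + killed B x0 n h"
    unfolding killed_def by (intro nn_integral_add) measurable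
  finally show ?thesis .
qed

lemma killed_cmult: "killed B x0 n (\<lambda>x. a * g x) = a * killed B x0 n g"
proof -
  have "killed B x0 n (\<lambda>x. a * g x) =
    (\<integral>\<^sup>+\<omega>. a * (if stays_in B x0 n \<omega> then g (gw_process \<xi> I x0 n \<omega>) else 0) \<partial>M)"
    unfolding killed_def by (intro nn_integral_cong) auto
  also have "\<dots> = a * killed B x0 n g"
    unfolding killed_def by (intro nn_integral_cmult) measurable
  finally show ?thesis .
qed

lemma gw_law_hitting_time:
  "measure (gw_law M \<xi> I x0) {X. hitting_time A X > enat n} =
     prob {\<omega> \<in> space M. stays_in (\<lambda>_. {x. real x > A}) x0 n \<omega>}"
proof -
  let ?N = "\<Pi>\<^sub>M n\<in>UNIV. count_space (UNIV :: nat set)"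
  have sets: "{X. hitting_time A X > enat n} \<in> sets ?N"
  proof -
    have "{X \<in> space ?N. \<forall>j\<in>{..n}. real (X j) > A} \<in> sets ?N" by measurable
    then show ?thesis by (simp add: hitting_time_gt_iff space_PiM Ball_def)
  qed
  have meas: "(\<lambda>\<omega> n. gw_process \<xi> I x0 n \<omega>) \<in> measurable M ?N"
    by (rule measurable_PiM_single') auto
  show ?thesis
    unfolding gw_law_def measure_distr[OF meas sets]
    by (intro arg_cong[where f = prob]) (auto simp: hitting_time_gt_iff stays_in_def)
qed

end

section \<open>Drift of power functions and the Lyapunov function\<close>

lemma (in prob_space) centred_positive_prob:
  fixes Y :: "'a \<Rightarrow> real"
  assumes "integrable M Y" "expectation Y = 0" "expectation (\<lambda>\<omega>. (Y \<omega>)\<^sup>2) \<noteq> 0"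
  shows "0 < prob {\<omega> \<in> space M. 0 < Y \<omega>}"
proof (rule ccontr)
  have [measurable]: "Y \<in> borel_measurable M" using assms(1) by auto
  assume "\<not> ?thesis"
  then have "prob {\<omega> \<in> space M. 0 < Y \<omega>} = 0"
    using measure_nonneg[of M "{\<omega> \<in> space M. 0 < Y \<omega>}"] by linarith
  then have "AE \<omega> in M. \<not> 0 < Y \<omega>"
    by (subst (asm) prob_eq_0) (auto elim: eventually_mono)
  then have "AE \<omega> in M. 0 \<le> - Y \<omega>" by eventually_elim auto
  then have "AE \<omega> in M. - Y \<omega> = 0"
    using assms integral_nonneg_eq_0_iff_AE[of M "\<lambda>\<omega>. - Y \<omega>"] by auto
  then have "AE \<omega> in M. (Y \<omega>)\<^sup>2 = 0" by eventually_elim auto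
  then have "expectation (\<lambda>\<omega>. (Y \<omega>)\<^sup>2) = 0" by (rule integral_eq_zero_AE)
  with assms(3) show False by simp
qed

context gw_immigration
begin

lemma prob_offspring_all_in:
  "prob {\<omega> \<in> space M. (\<forall>k\<in>{1..x}. \<xi> k m \<omega> \<in> S) \<and> I m \<omega> \<in> T} =
     prob {\<omega> \<in> space M. \<xi> 1 1 \<omega> \<in> S} ^ x * prob {\<omega> \<in> space M. I 1 \<omega> \<in> T}"
proof -
  let ?J = "insert (Inr m) ((\<lambda>k. Inl (k, m)) ` {1..x}) :: ((nat \<times> nat) + nat) set"
  let ?F = "case_sum (\<lambda>(k, n). \<xi> k n) I"
  let ?Y = "case_sum (\<lambda>_. S) (\<lambda>_. T)"
  have "prob (\<Inter>i\<in>?J. ?F i -` ?Y i \<inter> space M) = (\<Prod>i\<in>?J. prob (?F i -` ?Y i \<inter> space M))"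
    by (rule indep_varsD[OF indep]) auto
  also have "(\<Inter>i\<in>?J. ?F i -` ?Y i \<inter> space M) =
      {\<omega> \<in> space M. (\<forall>k\<in>{1..x}. \<xi> k m \<omega> \<in> S) \<and> I m \<omega> \<in> T}"
    by auto
  also have "(\<Prod>i\<in>?J. prob (?F i -` ?Y i \<inter> space M)) =
      prob (I m -` T \<inter> space M) * (\<Prod>k\<in>{1..x}. prob (\<xi> k m -` S \<inter> space M))"
    by (subst prod.insert) (auto simp: prod.reindex inj_on_def)
  also have "prob (I m -` T \<inter> space M) = prob {\<omega> \<in> space M. I 1 \<omega> \<in> T}"
    using measure_distr[of "I m" M "count_space UNIV" T] measure_distr[of "I 1" M "count_space UNIV" T]
      I_identically_distributed[of m]
    by (simp add: vimage_def Int_def conj_commute)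
  also have "(\<Prod>k\<in>{1..x}. prob (\<xi> k m -` S \<inter> space M)) = prob {\<omega> \<in> space M. \<xi> 1 1 \<omega> \<in> S} ^ x"
  proof -
    have "prob (\<xi> k m -` S \<inter> space M) = prob {\<omega> \<in> space M. \<xi> 1 1 \<omega> \<in> S}" for k
      using measure_distr[of "\<xi> k m" M "count_space UNIV" S]
        measure_distr[of "\<xi> 1 1" M "count_space UNIV" S] \<xi>_identically_distributed[of k m]
      by (simp add: vimage_def Int_def conj_commute)
    then show ?thesis by simp
  qed
  finally show ?thesis by (simp add: mult.commute)
qed

end

lemma eventually_powr_dominates:
  fixes a b C \<kappa> :: real
  assumes "a < b" "0 < \<kappa>"
  obtains L :: nat where "1 \<le> L" "\<And>x::nat. L \<le> x \<Longrightarrow> C * x powr a \<le> \<kappa> * x powr b"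
proof -
  have "((\<lambda>x::nat. C * real x powr (a - b)) \<longlongrightarrow> C * 0) sequentially"
    using assms(1)
    by (intro tendsto_mult tendsto_const tendsto_neg_powr filterlim_real_sequentially) auto
  then have "\<forall>\<^sub>F x::nat in sequentially. C * real x powr (a - b) < \<kappa>"
    using assms(2) by (auto dest: order_tendstoD(2))
  then obtain L :: nat where L: "\<And>x. L \<le> x \<Longrightarrow> C * real x powr (a - b) < \<kappa>"
    by (auto simp: eventually_sequentially)
  show thesis
  proof (rule that[of "max 1 L"])
    fix x :: nat assume "max 1 L \<le> x"
    then have x: "1 \<le> x" "C * real x powr (a - b) < \<kappa>" using L by auto
    have "C * x powr a = C * real x powr (a - b) * real x powr b"
      using x(1) by (simp add: powr_diff)
    also have "\<dots> \<le> \<kappa> * real x powr b" using x by (intro mult_right_mono) auto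
    finally show "C * x powr a \<le> \<kappa> * x powr b" .
  qed simp
qed

context critical_gw_immigration
begin

lemma next_gen_mean:
  "integrable M (\<lambda>\<omega>. real (next_gen m x \<omega>))"
  "expectation (\<lambda>\<omega>. real (next_gen m x \<omega>)) = x + c"
  by (rule increment_moments; simp)+

lemma next_gen_powr_integrable:
  assumes "0 < q" "q < 1"
  shows "integrable M (\<lambda>\<omega>. real (next_gen m x \<omega>) powr q)"
  by (rule powr_drift[OF assms])

text \<open>
  The exponent \<open>1 - \<theta>\<close>.
\<close>

definition crit :: real where "crit = 1 - 2 * c / d"

lemma crit_bounds: "0 < crit" "crit < 1"
  using c_less c_pos d_pos by (auto simp: crit_def field_simps)

lemma drift_coefficient: "c - (1 - q) * d / 2 = (q - crit) * d / 2"
  using d_pos by (simp add: crit_def field_simps)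

lemma powr_drift_below:
  assumes "0 < q" "q < crit"
  obtains \<kappa> :: real and L :: nat where "0 < \<kappa>" "1 \<le> L"
    "\<And>m x. L \<le> x \<Longrightarrow> expectation (\<lambda>\<omega>. real (next_gen m x \<omega>) powr q) \<le> x powr q - \<kappa> * x powr (q - 1)"
proof -
  have q: "0 < q" "q < 1" using assms crit_bounds by auto
  obtain C where C: "\<And>m x. integrable M (\<lambda>\<omega>. real (next_gen m x \<omega>) powr q)"
    "\<And>m x. 1 \<le> x \<Longrightarrow> \<bar>expectation (\<lambda>\<omega>. real (next_gen m x \<omega>) powr q) -
       (x powr q + q * (c - (1 - q) * d / 2) * x powr (q - 1))\<bar> \<le> C * x powr (q - r / 2)"
    using powr_drift[OF q] by blast
  define \<kappa> where "\<kappa> = q * (crit - q) * d / 4"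
  have \<kappa>: "0 < \<kappa>" using assms d_pos by (simp add: \<kappa>_def)
  have eq: "q * (c - (1 - q) * d / 2) = - (2 * \<kappa>)"
    unfolding drift_coefficient by (simp add: \<kappa>_def field_simps)
  obtain L :: nat where L: "1 \<le> L" "\<And>x::nat. L \<le> x \<Longrightarrow> C * x powr (q - r / 2) \<le> \<kappa> * x powr (q - 1)"
    using eventually_powr_dominates[of "q - r / 2" "q - 1" \<kappa> C] \<kappa> r by auto
  show thesis
  proof (rule that[OF \<kappa> L(1)])
    fix m x assume x: "L \<le> x"
    then have "1 \<le> x" using L(1) by simp
    then show "expectation (\<lambda>\<omega>. real (next_gen m x \<omega>) powr q) \<le> x powr q - \<kappa> * x powr (q - 1)"
      using C(2)[of x m] L(2)[OF x] unfolding eq by (simp add: abs_le_iff)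
  qed
qed

lemma powr_drift_above:
  assumes "crit < q" "q < 1"
  obtains L :: nat where "1 \<le> L"
    "\<And>m x. L \<le> x \<Longrightarrow> x powr q \<le> expectation (\<lambda>\<omega>. real (next_gen m x \<omega>) powr q)"
proof -
  have q: "0 < q" "q < 1" using assms crit_bounds by auto
  obtain C where C: "\<And>m x. integrable M (\<lambda>\<omega>. real (next_gen m x \<omega>) powr q)"
    "\<And>m x. 1 \<le> x \<Longrightarrow> \<bar>expectation (\<lambda>\<omega>. real (next_gen m x \<omega>) powr q) -
       (x powr q + q * (c - (1 - q) * d / 2) * x powr (q - 1))\<bar> \<le> C * x powr (q - r / 2)"
    using powr_drift[OF q] by blast
  define \<kappa> where "\<kappa> = q * (c - (1 - q) * d / 2)"
  have \<kappa>: "0 < \<kappa>" using assms d_pos crit_bounds by (simp add: \<kappa>_def drift_coefficient)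
  obtain L :: nat where L: "1 \<le> L" "\<And>x::nat. L \<le> x \<Longrightarrow> C * x powr (q - r / 2) \<le> \<kappa> * x powr (q - 1)"
    using eventually_powr_dominates[of "q - r / 2" "q - 1" \<kappa> C] \<kappa> r by auto
  show thesis
  proof (rule that[OF L(1)])
    fix m x assume x: "L \<le> x"
    then have "1 \<le> x" using L(1) by simp
    then show "x powr q \<le> expectation (\<lambda>\<omega>. real (next_gen m x \<omega>) powr q)"
      using C(2)[of x m] L(2)[OF x] unfolding \<kappa>_def[symmetric] by (simp add: abs_le_iff)
  qed
qed

lemma offspring_zero_pos: "0 < prob {\<omega> \<in> space M. \<xi> 1 1 \<omega> \<in> {0}}"
proof -
  have "0 < prob {\<omega> \<in> space M. 0 < 1 - real (\<xi> 1 1 \<omega>)}"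
    using \<xi>_int \<xi>_mean \<xi>_var d_pos
    by (intro centred_positive_prob) (simp_all add: power2_commute[of 1] prob_space)
  then show ?thesis by simp
qed

lemma offspring_ge_2_pos: "0 < prob {\<omega> \<in> space M. \<xi> 1 1 \<omega> \<in> {2..}}"
proof -
  have "0 < prob {\<omega> \<in> space M. 0 < real (\<xi> 1 1 \<omega>) - 1}"
    using \<xi>_int \<xi>_mean \<xi>_var d_pos by (intro centred_positive_prob) (simp_all add: prob_space)
  also have "{\<omega> \<in> space M. 0 < real (\<xi> 1 1 \<omega>) - 1} = {\<omega> \<in> space M. \<xi> 1 1 \<omega> \<in> {2..}}"
    by auto
  finally show ?thesis .
qed

text \<open>
  From a bounded size the process may fall to \<open>A\<close> at once: nobody has children and at most \<open>A\<close>
  immigrants arrive.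
\<close>

lemma fall_in_one_step:
  assumes "0 < prob {\<omega> \<in> space M. real (I 1 \<omega>) \<le> A}"
  obtains s where "0 < s" "\<And>m x. x \<le> L \<Longrightarrow> s \<le> prob {\<omega> \<in> space M. real (next_gen m x \<omega>) \<le> A}"
proof (rule that)
  let ?z = "prob {\<omega> \<in> space M. \<xi> 1 1 \<omega> \<in> {0}}" and ?T = "{y. real y \<le> A}"
  let ?s = "?z ^ L * prob {\<omega> \<in> space M. I 1 \<omega> \<in> ?T}"
  show "0 < ?s" using assms offspring_zero_pos by simp
  fix m x :: nat assume "x \<le> L"
  then have "?s \<le> ?z ^ x * prob {\<omega> \<in> space M. I 1 \<omega> \<in> ?T}"
    by (intro mult_right_mono power_decreasing) auto
  also have "\<dots> = prob {\<omega> \<in> space M. (\<forall>k\<in>{1..x}. \<xi> k m \<omega> \<in> {0}) \<and> I m \<omega> \<in> ?T}"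
    by (rule prob_offspring_all_in[symmetric])
  also have "\<dots> \<le> prob {\<omega> \<in> space M. real (next_gen m x \<omega>) \<le> A}"
    by (intro finite_measure_mono) (auto simp: next_gen_def)
  finally show "?s \<le> prob {\<omega> \<in> space M. real (next_gen m x \<omega>) \<le> A}" .
qed

text \<open>
  The function \<open>V x = x^\<alpha> + b\<close>, killed at \<open>A\<close>, has the right drift everywhere above \<open>A\<close>. Beyond a level
  \<open>L\<close> the power alone provides it. Up to \<open>L\<close> the expected power is bounded, and the loss of \<open>b\<close> with
  probability at least \<open>s\<close> outweighs it once \<open>b\<close> is large.
\<close>

lemma Lyapunov_function:
  assumes A: "0 < A" "0 < prob {\<omega> \<in> space M. real (I 1 \<omega>) \<le> A}" and \<alpha>: "0 < \<alpha>" "\<alpha> < crit"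
  obtains b \<kappa> :: real where "0 \<le> b" "0 < \<kappa>"
    "\<And>m x. A < real x \<Longrightarrow> expectation (\<lambda>\<omega>. real (next_gen m x \<omega>) powr \<alpha>) +
       b * prob {\<omega> \<in> space M. A < real (next_gen m x \<omega>)} \<le> x powr \<alpha> + b - \<kappa> * x powr (\<alpha> - 1)"
proof -
  obtain \<kappa> :: real and L :: nat where \<kappa>: "0 < \<kappa>" and L: "1 \<le> L"
    "\<And>m x. L \<le> x \<Longrightarrow> expectation (\<lambda>\<omega>. real (next_gen m x \<omega>) powr \<alpha>) \<le> x powr \<alpha> - \<kappa> * x powr (\<alpha> - 1)"
    using powr_drift_below[OF \<alpha>] by blast
  obtain s where s: "0 < s" "\<And>m x. x \<le> L \<Longrightarrow> s \<le> prob {\<omega> \<in> space M. real (next_gen m x \<omega>) \<le> A}"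
    using fall_in_one_step[OF A(2), of L] by blast
  have int: "integrable M (\<lambda>\<omega>. real (next_gen m x \<omega>) powr \<alpha>)" for m x
    using \<alpha> crit_bounds by (intro next_gen_powr_integrable) auto
  define b where "b = (1 + L + c + \<kappa>) / s"
  have b: "0 \<le> b" using s(1) \<kappa> c_pos by (simp add: b_def)
  show thesis
  proof (rule that[OF b \<kappa>])
    fix m x :: nat assume x: "A < real x"
    let ?P = "prob {\<omega> \<in> space M. A < real (next_gen m x \<omega>)}"
    show "expectation (\<lambda>\<omega>. real (next_gen m x \<omega>) powr \<alpha>) + b * ?P \<le> x powr \<alpha> + b - \<kappa> * x powr (\<alpha> - 1)"
    proof (cases "L \<le> x")
      case True
      have "b * ?P \<le> b * 1" using b by (intro mult_left_mono) auto
      then show ?thesis using L(2)[OF True, of m] by simp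
    next
      case False
      have "?P = 1 - prob {\<omega> \<in> space M. real (next_gen m x \<omega>) \<le> A}"
        using prob_neg[of "\<lambda>\<omega>. real (next_gen m x \<omega>) \<le> A"] by (simp add: not_le)
      also have "\<dots> \<le> 1 - s" using s(2)[of x m] False by simp
      finally have "b * ?P \<le> b * (1 - s)" using b by (rule mult_left_mono)
      also have "\<dots> = b - (1 + L + c + \<kappa>)" using s(1) by (simp add: b_def field_simps)
      finally have 1: "b * ?P \<le> b - (1 + L + c + \<kappa>)" .
      have "u powr \<alpha> \<le> 1 + u" if "0 \<le> u" for u :: real
      proof (cases "u \<le> 1")
        case True
        then show ?thesis using powr_le1[of \<alpha> u] \<alpha> that by simp
      next
        case False
        then show ?thesis using powr_mono[of \<alpha> 1 u] \<alpha> crit_bounds by simp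
      qed
      then have "expectation (\<lambda>\<omega>. real (next_gen m x \<omega>) powr \<alpha>) \<le>
          expectation (\<lambda>\<omega>. 1 + real (next_gen m x \<omega>))"
        using int next_gen_mean(1) by (intro integral_mono) auto
      also have "\<dots> = 1 + x + c" using next_gen_mean[of m x] by (simp add: prob_space)
      also have "\<dots> \<le> 1 + L + c" using False by simp
      finally have 2: "expectation (\<lambda>\<omega>. real (next_gen m x \<omega>) powr \<alpha>) \<le> 1 + L + c" .
      have "real x powr (\<alpha> - 1) \<le> real x powr 0"
        using x A \<alpha> crit_bounds by (intro powr_mono) auto
      then have "\<kappa> * x powr (\<alpha> - 1) \<le> \<kappa> * 1"
        using \<kappa> x A by (intro mult_left_mono) auto
      then show ?thesis using 1 2 powr_ge_zero[of x \<alpha>] by linarith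
    qed
  qed
qed

section \<open>Upper bound for the survival probability\<close>

text \<open>
  For a fixed horizon \<open>N\<close>, backward induction shows that with \<open>j\<close> steps to go the survival probability
  from \<open>x\<close> is at most \<open>g j x\<close>, a constant times \<open>V x / N^\<alpha>\<close> plus \<open>1 - j / N\<close>, cut at one. For
  \<open>x \<ge> N\<close> the first term alone is at least one. For \<open>x < N\<close> the drift of \<open>V\<close>, at most
  \<open>- \<kappa> N^(\<alpha> - 1)\<close>, pays for the decrease of the second term by \<open>1 / N\<close>. At \<open>j = N\<close> only the first term
  is left. This combines the maximal inequality for \<open>V\<close> with the bound on the time spent below \<open>N\<close>
  without any stopping time.
\<close>

lemma survival_upper_bound:
  assumes A: "0 < A" "0 < prob {\<omega> \<in> space M. real (I 1 \<omega>) \<le> A}" and \<alpha>: "0 < \<alpha>" "\<alpha> < crit"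
    and x0: "A < real x0"
  obtains C where "0 < C"
    "\<And>n. 1 \<le> n \<Longrightarrow> prob {\<omega> \<in> space M. stays_in (\<lambda>_. {x. A < real x}) x0 n \<omega>} \<le> C / n powr \<alpha>"
proof -
  obtain b \<kappa> :: real where b: "0 \<le> b" and \<kappa>: "0 < \<kappa>" and drift:
    "\<And>m x. A < real x \<Longrightarrow> expectation (\<lambda>\<omega>. real (next_gen m x \<omega>) powr \<alpha>) +
       b * prob {\<omega> \<in> space M. A < real (next_gen m x \<omega>)} \<le> x powr \<alpha> + b - \<kappa> * x powr (\<alpha> - 1)"
    using Lyapunov_function[OF A \<alpha>] by blast
  have int: "integrable M (\<lambda>\<omega>. real (next_gen m x \<omega>) powr \<alpha>)" for m x
    using \<alpha> crit_bounds by (intro next_gen_powr_integrable) auto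
  let ?B = "\<lambda>_::nat. {x. A < real x}"
  \<comment> \<open>The factor \<open>1\<close> serves the sizes above the horizon, \<open>1 / \<kappa>\<close> those below it.\<close>
  define H where "H = max 1 (1 / \<kappa>)"
  have H: "1 \<le> H" "1 \<le> H * \<kappa>" using \<kappa> by (auto simp: H_def max_def field_simps)
  define V where "V x = real x powr \<alpha> + b" for x :: nat
  have V0: "0 \<le> V x" for x using b by (simp add: V_def)
  have bound: "prob {\<omega> \<in> space M. stays_in ?B x0 N \<omega>} \<le> H * V x0 / N powr \<alpha>" if N: "1 \<le> N" for N :: nat
  proof -
    define K where "K = H / N powr \<alpha>"
    have K0: "0 \<le> K" using H by (simp add: K_def)
    define g where "g j x = min 1 (K * V x + (1 - real j / N))" for j x
    have step: "killed_step (?B j) m (\<lambda>x. ennreal (g j x)) x \<le> ennreal (g (Suc j) x)"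
      if j: "Suc j \<le> N" and x: "A < real x" for j m x
    proof -
      let ?n = "next_gen m x"
      have e: "0 \<le> 1 - real j / N" using j by (simp add: field_simps)
      have one: "killed_step (?B j) m (\<lambda>x. ennreal (g j x)) x \<le> 1"
      proof -
        have "killed_step (?B j) m (\<lambda>x. ennreal (g j x)) x \<le> (\<integral>\<^sup>+\<omega>. 1 \<partial>M)"
          unfolding killed_step_def
          by (intro nn_integral_mono) (auto simp: g_def min_def intro!: ennreal_le_1[THEN iffD2])
        then show ?thesis by (simp add: emeasure_space_1)
      qed
      show ?thesis
      proof (cases "N \<le> x")
        case True
        have "1 \<le> H * (real x powr \<alpha> / N powr \<alpha>)"
        proof -
          have "real N powr \<alpha> \<le> real x powr \<alpha>" using True \<alpha> by (intro powr_mono2) auto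
          then have "1 \<le> real x powr \<alpha> / N powr \<alpha>" using N by (simp add: field_simps)
          then show ?thesis using mult_mono[OF H(1), of 1 "real x powr \<alpha> / N powr \<alpha>"] H(1) by simp
        qed
        also have "\<dots> \<le> K * V x" using b H by (simp add: K_def V_def divide_right_mono)
        also have "\<dots> \<le> K * V x + (1 - real (Suc j) / N)"
          using j by (simp add: field_simps)
        finally show ?thesis using one by (simp add: g_def)
      next
        case False
        let ?P = "prob {\<omega> \<in> space M. A < real (?n \<omega>)}"
        let ?f = "\<lambda>\<omega>. K * (real (?n \<omega>) powr \<alpha> + b * indicator {\<omega> \<in> space M. A < real (?n \<omega>)} \<omega>) + (1 - real j / N)"
        have ind: "integrable M (\<lambda>\<omega>. indicat_real {\<omega> \<in> space M. A < real (?n \<omega>)} \<omega>)"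
          by (intro integrable_real_indicator) (auto simp: emeasure_eq_measure)
        have E_ind: "expectation (\<lambda>\<omega>. indicat_real {\<omega> \<in> space M. A < real (?n \<omega>)} \<omega>) = ?P"
          by (subst Bochner_Integration.integral_indicator) (auto intro!: arg_cong[where f = prob])
        have f_int: "integrable M ?f"
          using int[of m x] ind
          by (intro Bochner_Integration.integrable_add integrable_mult_right) auto
        have "killed_step (?B j) m (\<lambda>x. ennreal (g j x)) x \<le> (\<integral>\<^sup>+\<omega>. ennreal (?f \<omega>) \<partial>M)"
          unfolding killed_step_def
        proof (rule nn_integral_mono)
          fix \<omega> assume "\<omega> \<in> space M"
          then show "(if ?n \<omega> \<in> ?B j then ennreal (g j (?n \<omega>)) else 0) \<le> ennreal (?f \<omega>)"
            by (auto simp: g_def V_def intro!: ennreal_leI)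
        qed
        also have "\<dots> = ennreal (expectation ?f)"
          using f_int by (rule nn_integral_eq_integral) (auto intro!: add_nonneg_nonneg mult_nonneg_nonneg K0 b e)
        also have "expectation ?f = K * (expectation (\<lambda>\<omega>. real (?n \<omega>) powr \<alpha>) + b * ?P) + (1 - real j / N)"
          using int[of m x] ind E_ind by (simp add: prob_space)
        also have "\<dots> \<le> K * (V x - \<kappa> * x powr (\<alpha> - 1)) + (1 - real j / N)"
          using drift[OF x, of m] K0 by (intro add_right_mono mult_left_mono) (auto simp: V_def)
        also have "\<dots> \<le> K * V x + (1 - real (Suc j) / N)"
        proof -
          have "1 / N = real N powr (\<alpha> - 1) / N powr \<alpha>"
            using N by (simp add: powr_diff)
          also have "\<dots> \<le> (H * \<kappa>) * (real x powr (\<alpha> - 1) / N powr \<alpha>)"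
          proof -
            have "real N powr (\<alpha> - 1) \<le> real x powr (\<alpha> - 1)"
              using False x A \<alpha> crit_bounds by (intro powr_mono2') auto
            then show ?thesis
              using mult_mono[OF H(2), of "real N powr (\<alpha> - 1) / N powr \<alpha>" "real x powr (\<alpha> - 1) / N powr \<alpha>"] H
              by (simp add: divide_right_mono)
          qed
          also have "\<dots> = K * (\<kappa> * x powr (\<alpha> - 1))" by (simp add: K_def)
          finally show ?thesis by (simp add: right_diff_distrib add_divide_distrib)
        qed
        finally have "killed_step (?B j) m (\<lambda>x. ennreal (g j x)) x \<le> ennreal (K * V x + (1 - real (Suc j) / N))"
          by (simp add: ennreal_leI)
        with one show ?thesis by (simp add: g_def min_def)
      qed
    qed
    have "killed ?B x0 N (\<lambda>_. 1) \<le> killed ?B x0 (N - j) (\<lambda>x. ennreal (g j x))" if "j \<le> N" for j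
      using that
    proof (induction j)
      case 0
      have "g 0 x = 1" for x using K0 V0[of x] by (simp add: g_def min_def)
      then show ?case by simp
    next
      case (Suc j)
      then have "killed ?B x0 N (\<lambda>_. 1) \<le> killed ?B x0 (Suc (N - Suc j)) (\<lambda>x. ennreal (g j x))"
        by (simp add: Suc_diff_Suc)
      also have "\<dots> \<le> killed ?B x0 (N - Suc j) (\<lambda>x. ennreal (g (Suc j) x))"
        unfolding killed_Suc using step[OF Suc.prems] by (intro killed_mono) auto
      finally show ?case .
    qed
    from this[of N] have "killed ?B x0 N (\<lambda>_. 1) \<le> ennreal (g N x0)"
      using x0 by (simp add: killed_0)
    also have "\<dots> \<le> ennreal (K * V x0)"
      using N by (intro ennreal_leI) (simp add: g_def)
    finally have "prob {\<omega> \<in> space M. stays_in ?B x0 N \<omega>} \<le> K * V x0"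
      using K0 V0[of x0] by (subst (asm) killed_one, subst (asm) ennreal_le_iff) auto
    then show ?thesis by (simp add: K_def)
  qed
  show thesis
  proof (rule that[of "H * V x0 + 1"])
    show "0 < H * V x0 + 1" using H V0[of x0] by (simp add: add_nonneg_pos)
    fix n :: nat assume "1 \<le> n"
    from bound[OF this] show "prob {\<omega> \<in> space M. stays_in ?B x0 n \<omega>} \<le> (H * V x0 + 1) / n powr \<alpha>"
      by (rule order_trans) (intro divide_right_mono, auto)
  qed
qed

end

section \<open>Lower bound for the survival probability\<close>

lemma sum_powr_le:
  fixes a :: real
  assumes a: "0 < a" "a < 1"
  shows "(\<Sum>j=1..n. 1 / real j powr a) \<le> real n powr (1 - a) / (1 - a)"
proof (induction n)
  case (Suc n)
  have "1 / real (Suc n) powr a \<le> (real (Suc n) powr (1 - a) - real n powr (1 - a)) / (1 - a)"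
  proof (cases "n = 0")
    case True
    then show ?thesis using a by simp
  next
    case False
    have "\<exists>z>real n. z < real (Suc n) \<and>
        real (Suc n) powr (1 - a) - real n powr (1 - a) = (real (Suc n) - real n) * ((1 - a) * z powr (- a))"
      using False by (intro MVT2) (auto intro!: derivative_eq_intros)
    then obtain z where z: "real n < z" "z < real (Suc n)"
      "real (Suc n) powr (1 - a) - real n powr (1 - a) = (1 - a) * z powr (- a)"
      by auto
    have "1 / real (Suc n) powr a = real (Suc n) powr (- a)" by (simp add: powr_minus_divide)
    also have "\<dots> \<le> z powr (- a)" using z False a by (intro powr_mono2') auto
    finally show ?thesis unfolding z(3) using a by simp
  qed
  then show ?case using Suc by (simp add: diff_divide_distrib)
qed simp

text \<open>
  Truncation at level \<open>K\<close>: a bounded part plus a part controlled by the first moment.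
\<close>

lemma powr_split:
  fixes K x \<beta> :: real
  assumes "0 < K" "0 \<le> x" "0 < \<beta>" "\<beta> < 1"
  shows "x powr \<beta> \<le> K powr \<beta> + K powr (\<beta> - 1) * x"
proof (cases "x \<le> K")
  case True
  then have "x powr \<beta> \<le> K powr \<beta>" using assms by (intro powr_mono2) auto
  moreover have "0 \<le> K powr (\<beta> - 1) * x" using assms by simp
  ultimately show ?thesis by linarith
next
  case False
  then have "x powr \<beta> = x powr (\<beta> - 1) * x" using assms by (simp add: powr_diff)
  also have "\<dots> \<le> K powr (\<beta> - 1) * x"
    using False assms by (intro mult_right_mono powr_mono2') auto
  finally show ?thesis using powr_ge_zero[of K \<beta>] by linarith
qed

context critical_gw_immigration
begin

text \<open>
  If the first \<open>y\<close> individuals all have two children or more, the next generation exceeds \<open>y\<close>. High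
  levels are reached by repeating this: a single step need not suffice, as the offspring law may have
  bounded support.
\<close>

lemma growth_pos:
  obtains s where "0 < s" "\<And>m x y. y \<le> x \<Longrightarrow> 1 \<le> y \<Longrightarrow> s ^ y \<le> prob {\<omega> \<in> space M. Suc y \<le> next_gen m x \<omega>}"
proof (rule that[OF offspring_ge_2_pos])
  let ?s = "prob {\<omega> \<in> space M. \<xi> 1 1 \<omega> \<in> {2..}}"
  fix m x y :: nat assume y: "y \<le> x" "1 \<le> y"
  have "?s ^ y = prob {\<omega> \<in> space M. (\<forall>k\<in>{1..y}. \<xi> k m \<omega> \<in> {2..}) \<and> I m \<omega> \<in> UNIV}"
    by (subst prob_offspring_all_in) (simp add: prob_space)
  also have "\<dots> \<le> prob {\<omega> \<in> space M. Suc y \<le> next_gen m x \<omega>}"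
  proof (intro finite_measure_mono subsetI)
    fix \<omega> assume \<omega>: "\<omega> \<in> {\<omega> \<in> space M. (\<forall>k\<in>{1..y}. \<xi> k m \<omega> \<in> {2..}) \<and> I m \<omega> \<in> UNIV}"
    have "2 * y = (\<Sum>k=1..y. 2)" by simp
    also have "\<dots> \<le> (\<Sum>k=1..y. \<xi> k m \<omega>)" using \<omega> by (intro sum_mono) auto
    also have "\<dots> \<le> (\<Sum>k=1..x. \<xi> k m \<omega>)" using y by (intro sum_mono2) auto
    finally show "\<omega> \<in> {\<omega> \<in> space M. Suc y \<le> next_gen m x \<omega>}"
      using \<omega> y by (auto simp: next_gen_def)
  qed measurable
  finally show "?s ^ y \<le> prob {\<omega> \<in> space M. Suc y \<le> next_gen m x \<omega>}" .
qed

lemma killed_step_id: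
  "killed_step S m (\<lambda>x. ennreal (real x)) y \<le> ennreal (real y) + ennreal c"
proof -
  have "killed_step S m (\<lambda>x. ennreal (real x)) y \<le> (\<integral>\<^sup>+\<omega>. ennreal (real (next_gen m y \<omega>)) \<partial>M)"
    unfolding killed_step_def by (intro nn_integral_mono) auto
  also have "\<dots> = ennreal (y + c)"
    using next_gen_mean[of m y] by (subst nn_integral_eq_integral) auto
  finally show ?thesis using c_pos by simp
qed

lemma surviving_mean:
  assumes A: "0 < A" "0 < prob {\<omega> \<in> space M. real (I 1 \<omega>) \<le> A}" and \<alpha>: "0 < \<alpha>" "\<alpha> < crit"
    and x0: "A < real x0"
  obtains D where "0 < D"
    "\<And>n. 1 \<le> n \<Longrightarrow> killed (\<lambda>_. {x. A < real x}) x0 n (\<lambda>x. ennreal (real x)) \<le> ennreal (D * n powr (1 - \<alpha>))"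
proof -
  let ?B = "\<lambda>_::nat. {x. A < real x}"
  define P where "P n = prob {\<omega> \<in> space M. stays_in ?B x0 n \<omega>}" for n
  obtain C where C: "0 < C" "\<And>n. 1 \<le> n \<Longrightarrow> P n \<le> C / n powr \<alpha>"
    unfolding P_def using survival_upper_bound[OF A \<alpha> x0] by blast
  have \<alpha>1: "\<alpha> < 1" using \<alpha> crit_bounds by simp
  have P0: "0 \<le> P n" for n by (simp add: P_def)
  have sum: "killed ?B x0 n (\<lambda>x. ennreal (real x)) \<le> ennreal (x0 + c * (\<Sum>j<n. P j))" for n
  proof (induction n)
    case 0
    show ?case using x0 by (simp add: killed_0)
  next
    case (Suc n)
    have "killed ?B x0 (Suc n) (\<lambda>x. ennreal (real x)) \<le>
        killed ?B x0 n (\<lambda>x. ennreal (real x) + ennreal c * 1)"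
      unfolding killed_Suc using killed_step_id by (intro killed_mono) simp
    also have "\<dots> = killed ?B x0 n (\<lambda>x. ennreal (real x)) + ennreal c * ennreal (P n)"
      by (simp only: killed_add killed_cmult killed_one P_def)
    also have "\<dots> \<le> ennreal (x0 + c * (\<Sum>j<n. P j)) + ennreal c * ennreal (P n)"
      by (intro add_right_mono Suc)
    also have "\<dots> = ennreal (x0 + c * (\<Sum>j<Suc n. P j))"
      using c_pos P0 by (simp add: sum_nonneg distrib_left add.assoc flip: ennreal_mult ennreal_plus)
    finally show ?case .
  qed
  have P_sum: "(\<Sum>j<n. P j) \<le> 1 + C * (n powr (1 - \<alpha>) / (1 - \<alpha>))" for n
  proof -
    have "(\<Sum>j<n. P j) \<le> (\<Sum>j\<in>{0..n}. P j)"
      using P0 by (intro sum_mono2) auto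
    also have "\<dots> = P 0 + (\<Sum>j=1..n. P j)"
      by (simp add: sum.atLeast_Suc_atMost)
    also have "\<dots> \<le> 1 + (\<Sum>j=1..n. C * (1 / real j powr \<alpha>))"
      using C(2) by (intro add_mono sum_mono) (auto simp: P_def)
    also have "(\<Sum>j=1..n. C * (1 / real j powr \<alpha>)) = C * (\<Sum>j=1..n. 1 / real j powr \<alpha>)"
      by (simp only: sum_distrib_left)
    also have "1 + C * (\<Sum>j=1..n. 1 / real j powr \<alpha>) \<le> 1 + C * (n powr (1 - \<alpha>) / (1 - \<alpha>))"
      using C(1) sum_powr_le[OF \<alpha>(1) \<alpha>1] by (intro add_left_mono mult_left_mono) auto
    finally show ?thesis .
  qed
  show thesis
  proof (rule that[of "x0 + c + c * C / (1 - \<alpha>)"])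
    show "0 < x0 + c + c * C / (1 - \<alpha>)" using c_pos C(1) \<alpha>1 by (simp add: add_pos_nonneg add_nonneg_pos)
    fix n :: nat assume n: "1 \<le> n"
    have n1: "1 \<le> real n powr (1 - \<alpha>)" using n \<alpha>1 by (intro ge_one_powr_ge_zero) auto
    have "x0 + c * (\<Sum>j<n. P j) \<le> x0 + c * (1 + C * (n powr (1 - \<alpha>) / (1 - \<alpha>)))"
      using P_sum c_pos by (intro add_left_mono mult_left_mono) auto
    also have "\<dots> = (x0 + c) * 1 + c * C / (1 - \<alpha>) * n powr (1 - \<alpha>)"
      by (simp add: algebra_simps)
    also have "\<dots> \<le> (x0 + c) * n powr (1 - \<alpha>) + c * C / (1 - \<alpha>) * n powr (1 - \<alpha>)"
      using n1 c_pos by (intro add_right_mono mult_left_mono) auto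
    also have "\<dots> = (x0 + c + c * C / (1 - \<alpha>)) * n powr (1 - \<alpha>)"
      by (simp add: distrib_right)
    finally show "killed ?B x0 n (\<lambda>x. ennreal (real x)) \<le>
        ennreal ((x0 + c + c * C / (1 - \<alpha>)) * n powr (1 - \<alpha>))"
      using sum[of n] by (auto intro: order_trans ennreal_leI)
  qed
qed

text \<open>
  The function \<open>W x = x^\<beta> - L^\<beta>\<close> is a submartingale above a level \<open>L\<close> and nonpositive up to \<open>L\<close>, so
  its expectation on survival above \<open>L\<close> does not decrease. To start from a positive value, the process
  climbs by one in each of its first \<open>L\<close> steps; this keeps it above \<open>A\<close> and takes it beyond \<open>L\<close>.
\<close>

lemma surviving_power_mean:
  assumes A: "0 < A" and x0: "A < real x0" and \<beta>: "crit < \<beta>" "\<beta> < 1"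
  obtains w k where "0 < w"
    "\<And>n. k \<le> n \<Longrightarrow> ennreal w \<le> killed (\<lambda>_. {x. A < real x}) x0 n (\<lambda>x. ennreal (real x powr \<beta>))"
proof -
  obtain L0 :: nat where L0: "1 \<le> L0"
    "\<And>m x. L0 \<le> x \<Longrightarrow> x powr \<beta> \<le> expectation (\<lambda>\<omega>. real (next_gen m x \<omega>) powr \<beta>)"
    using powr_drift_above[OF \<beta>] by blast
  define L where "L = max L0 (nat \<lceil>A\<rceil>)"
  have L: "A \<le> real L" "1 \<le> L" using L0(1) real_nat_ceiling_ge[of A] by (auto simp: L_def)
  have drift: "x powr \<beta> \<le> expectation (\<lambda>\<omega>. real (next_gen m x \<omega>) powr \<beta>)" if "L < x" for m x
    using L0(2)[of x m] that by (simp add: L_def)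
  have \<beta>0: "0 < \<beta>" using \<beta> crit_bounds by simp
  have x1: "1 \<le> x0" using A x0 by simp
  define B where "B j = (if j \<le> L then {x0 + j..} else {L<..})" for j
  have B_sub: "B j \<subseteq> {x. A < real x}" for j using x0 L by (auto simp: B_def)
  obtain s where s: "0 < s" "\<And>m x y. y \<le> x \<Longrightarrow> 1 \<le> y \<Longrightarrow> s ^ y \<le> prob {\<omega> \<in> space M. Suc y \<le> next_gen m x \<omega>}"
    using growth_pos by blast
  have climb: "0 < killed B x0 j (\<lambda>_. 1)" if "j \<le> L" for j
    using that
  proof (induction j)
    case 0
    show ?case by (simp add: killed_0 B_def)
  next
    case (Suc j)
    have "ennreal (s ^ (x0 + j)) \<le> killed_step (B (Suc j)) j (\<lambda>_. 1) y" if y: "y \<in> B j" for y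
    proof -
      have "ennreal (s ^ (x0 + j)) \<le> ennreal (prob {\<omega> \<in> space M. Suc (x0 + j) \<le> next_gen j y \<omega>})"
        using s(2)[of "x0 + j" y j] y Suc.prems x1 by (intro ennreal_leI) (simp add: B_def)
      also have "\<dots> = (\<integral>\<^sup>+\<omega>. indicator {\<omega> \<in> space M. Suc (x0 + j) \<le> next_gen j y \<omega>} \<omega> \<partial>M)"
        by (simp add: emeasure_eq_measure)
      also have "\<dots> = killed_step (B (Suc j)) j (\<lambda>_. 1) y"
        unfolding killed_step_def using Suc.prems by (intro nn_integral_cong) (auto simp: B_def)
      finally show ?thesis .
    qed
    then have "killed B x0 j (\<lambda>_. ennreal (s ^ (x0 + j)) * 1) \<le> killed B x0 (Suc j) (\<lambda>_. 1)"
      unfolding killed_Suc by (intro killed_mono) simp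
    moreover have "0 < ennreal (s ^ (x0 + j)) * killed B x0 j (\<lambda>_. 1)"
      using s(1) Suc by (simp add: ennreal_zero_less_mult_iff)
    ultimately show ?case unfolding killed_cmult by (rule less_le_trans[rotated])
  qed
  define W where "W x = real x powr \<beta> - real L powr \<beta>" for x
  have hold: "killed B x0 L (\<lambda>x. ennreal (W x)) \<le> killed B x0 n (\<lambda>x. ennreal (W x))" if "L \<le> n" for n
    using that
  proof (induction n rule: dec_induct)
    case (step n)
    have "ennreal (W y) \<le> killed_step (B (Suc n)) n (\<lambda>x. ennreal (W x)) y" if y: "y \<in> B n" for y
    proof -
      have Ly: "L < y" using y step(1) x1 by (auto simp: B_def split: if_splits)
      have int: "integrable M (\<lambda>\<omega>. real (next_gen n y \<omega>) powr \<beta>)"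
        using \<beta>0 \<beta>(2) by (rule next_gen_powr_integrable)
      have "W y \<le> expectation (\<lambda>\<omega>. W (next_gen n y \<omega>))"
        using drift[OF Ly, of n] int by (simp add: W_def prob_space)
      also have "\<dots> \<le> expectation (\<lambda>\<omega>. max 0 (W (next_gen n y \<omega>)))"
        using int by (intro integral_mono) (auto simp: W_def)
      finally have "ennreal (W y) \<le> ennreal (expectation (\<lambda>\<omega>. max 0 (W (next_gen n y \<omega>))))"
        by (rule ennreal_leI)
      also have "\<dots> = (\<integral>\<^sup>+\<omega>. ennreal (max 0 (W (next_gen n y \<omega>))) \<partial>M)"
        using int by (intro nn_integral_eq_integral[symmetric]) (auto simp: W_def)
      also have "\<dots> \<le> killed_step (B (Suc n)) n (\<lambda>x. ennreal (W x)) y"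
        unfolding killed_step_def
      proof (intro nn_integral_mono)
        fix \<omega>
        have "W z \<le> 0" if "z \<le> L" for z
          using that \<beta>0 by (simp add: W_def powr_mono2)
        then show "ennreal (max 0 (W (next_gen n y \<omega>))) \<le>
          (if next_gen n y \<omega> \<in> B (Suc n) then ennreal (W (next_gen n y \<omega>)) else 0)"
          using step(1) by (auto simp: B_def max_def not_less intro: antisym)
      qed
      finally show ?thesis .
    qed
    then have "killed B x0 n (\<lambda>x. ennreal (W x)) \<le> killed B x0 (Suc n) (\<lambda>x. ennreal (W x))"
      unfolding killed_Suc by (intro killed_mono)
    with step.IH show ?case by simp
  qed simp
  define \<epsilon> where "\<epsilon> = real (x0 + L) powr \<beta> - real L powr \<beta>"
  have \<epsilon>: "0 < \<epsilon>" using x1 \<beta>0 by (simp add: \<epsilon>_def powr_less_mono2)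
  define w where "w = \<epsilon> * prob {\<omega> \<in> space M. stays_in B x0 L \<omega>}"
  have "ennreal w = ennreal \<epsilon> * killed B x0 L (\<lambda>_. 1)"
    using \<epsilon> by (simp add: w_def killed_one ennreal_mult)
  also have "\<dots> = killed B x0 L (\<lambda>_. ennreal \<epsilon> * 1)" by (simp only: killed_cmult)
  also have "\<dots> \<le> killed B x0 L (\<lambda>x. ennreal (W x))"
  proof (rule killed_mono)
    fix x assume "x \<in> B L"
    then have "x0 + L \<le> x" by (simp add: B_def)
    then have "real (x0 + L) powr \<beta> \<le> real x powr \<beta>" using \<beta>0 by (intro powr_mono2) auto
    then have "\<epsilon> \<le> W x" by (simp add: \<epsilon>_def W_def)
    then show "ennreal \<epsilon> * 1 \<le> ennreal (W x)" by (simp add: ennreal_leI)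
  qed
  finally have w_le: "ennreal w \<le> killed B x0 L (\<lambda>x. ennreal (W x))" .
  show thesis
  proof (rule that)
    show "0 < w" using \<epsilon> climb[of L] by (simp add: w_def killed_one)
    fix n assume n: "L \<le> n"
    have "ennreal w \<le> killed B x0 n (\<lambda>x. ennreal (W x))"
      using w_le hold[OF n] by simp
    also have "\<dots> \<le> killed B x0 n (\<lambda>x. ennreal (real x powr \<beta>))"
      by (intro killed_mono ennreal_leI) (simp add: W_def)
    also have "\<dots> \<le> killed (\<lambda>_. {x. A < real x}) x0 n (\<lambda>x. ennreal (real x powr \<beta>))"
      using B_sub by (intro killed_subset)
    finally show "ennreal w \<le> killed (\<lambda>_. {x. A < real x}) x0 n (\<lambda>x. ennreal (real x powr \<beta>))" .
  qed
qed

text \<open>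
  The last exponent equals \<open>crit\<close> when \<open>\<alpha>\<close> and \<open>\<beta>\<close> do, and it is continuous there.
\<close>

lemma exponents_near_crit:
  assumes "crit < \<gamma>"
  obtains \<alpha> \<beta> where "0 < \<alpha>" "\<alpha> < crit" "crit < \<beta>" "\<beta> < 1" "\<beta> * ((1 - \<alpha>) / (1 - \<beta>)) \<le> \<gamma>"
proof -
  let ?h = "\<lambda>e. (crit + e) * ((1 - (crit - e)) / (1 - (crit + e)))"
  have "(?h \<longlongrightarrow> (crit + 0) * ((1 - (crit - 0)) / (1 - (crit + 0)))) (at_right 0)"
    using crit_bounds by (intro tendsto_intros) auto
  then have "(?h \<longlongrightarrow> crit) (at_right 0)" using crit_bounds by simp
  then have "\<forall>\<^sub>F e in at_right 0. ?h e < \<gamma>" using assms by (rule order_tendstoD)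
  moreover have "\<forall>\<^sub>F e in at_right 0. e < crit" "\<forall>\<^sub>F e in at_right 0. e < 1 - crit"
    using crit_bounds by (auto intro: eventually_at_rightI[of 0])
  moreover have "\<forall>\<^sub>F e in at_right (0::real). 0 < e"
    by (auto simp: eventually_at_right_less)
  ultimately have "\<forall>\<^sub>F e in at_right 0. ?h e < \<gamma> \<and> e < crit \<and> e < 1 - crit \<and> 0 < e"
    by eventually_elim auto
  then obtain e where "?h e < \<gamma>" "e < crit" "e < 1 - crit" "0 < e"
    using eventually_happens[of _ "at_right (0::real)"] by auto
  then show thesis by (intro that[of "crit - e" "crit + e"]) auto
qed

text \<open>
  With \<open>w\<close> the bound of \<open>surviving_power_mean\<close> and \<open>P\<close> the survival probability, truncation at \<open>K\<close> gives
  \<open>w \<le> K^\<beta> P n + K^(\<beta> - 1) D n^(1 - \<alpha>)\<close>. The level \<open>K = G n^s\<close> makes the last term equal to \<open>w / 2\<close>, and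
  \<open>P n\<close> is then at least \<open>(w / 2) K^(-\<beta>)\<close>. This holds from some time \<open>k\<close> on; monotonicity in \<open>n\<close>
  extends it to all \<open>n \<ge> 1\<close> at the price of a factor that depends on \<open>k\<close>.
\<close>

lemma survival_lower_bound:
  assumes A: "0 < A" "0 < prob {\<omega> \<in> space M. real (I 1 \<omega>) \<le> A}" and x0: "A < real x0"
    and \<gamma>: "crit < \<gamma>"
  obtains C where "0 < C"
    "\<And>n. 1 \<le> n \<Longrightarrow> C / n powr \<gamma> \<le> prob {\<omega> \<in> space M. stays_in (\<lambda>_. {x. A < real x}) x0 n \<omega>}"
proof -
  let ?B = "\<lambda>_::nat. {x. A < real x}"
  define P where "P n = prob {\<omega> \<in> space M. stays_in ?B x0 n \<omega>}" for n
  obtain \<alpha> \<beta> where \<alpha>: "0 < \<alpha>" "\<alpha> < crit" and \<beta>: "crit < \<beta>" "\<beta> < 1"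
    and \<gamma>_ge: "\<beta> * ((1 - \<alpha>) / (1 - \<beta>)) \<le> \<gamma>"
    using exponents_near_crit[OF \<gamma>] by blast
  have \<beta>0: "0 < \<beta>" using \<beta> crit_bounds by simp
  have \<alpha>1: "\<alpha> < 1" using \<alpha> crit_bounds by simp
  obtain D where D: "0 < D"
    "\<And>n. 1 \<le> n \<Longrightarrow> killed ?B x0 n (\<lambda>x. ennreal (real x)) \<le> ennreal (D * n powr (1 - \<alpha>))"
    using surviving_mean[OF A \<alpha> x0] by blast
  obtain w k where w: "0 < w"
    "\<And>n. k \<le> n \<Longrightarrow> ennreal w \<le> killed ?B x0 n (\<lambda>x. ennreal (real x powr \<beta>))"
    using surviving_power_mean[OF A(1) x0 \<beta>] by blast
  define s where "s = (1 - \<alpha>) / (1 - \<beta>)"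
  define G where "G = (2 * D / w) powr (1 / (1 - \<beta>))"
  have G: "0 < G" using D(1) w(1) by (simp add: G_def)
  have G_powr: "D * G powr (\<beta> - 1) = w / 2"
  proof -
    have "G powr (\<beta> - 1) = (2 * D / w) powr (1 / (1 - \<beta>) * (\<beta> - 1))"
      by (simp add: G_def powr_powr)
    also have "1 / (1 - \<beta>) * (\<beta> - 1) = -1" using \<beta>(2) by (simp add: field_simps)
    also have "(2 * D / w) powr -1 = w / (2 * D)" using D(1) w(1) by (simp add: powr_minus)
    finally show ?thesis using D(1) by simp
  qed
  have late: "w / 2 * G powr (- \<beta>) * real n powr (- \<beta> * s) \<le> P n" if n: "1 \<le> n" "k \<le> n" for n
  proof -
    define K where "K = G * real n powr s"
    have K: "0 < K" using G n by (simp add: K_def)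
    have "ennreal w \<le> killed ?B x0 n (\<lambda>x. ennreal (real x powr \<beta>))" by (rule w(2)[OF n(2)])
    also have "\<dots> \<le> killed ?B x0 n (\<lambda>x. ennreal (K powr \<beta>) * 1 + ennreal (K powr (\<beta> - 1)) * ennreal (real x))"
    proof (rule killed_mono)
      fix x :: nat
      have "ennreal (real x powr \<beta>) \<le> ennreal (K powr \<beta> + K powr (\<beta> - 1) * real x)"
        using powr_split[OF K, of "real x" \<beta>] \<beta>0 \<beta>(2) by (intro ennreal_leI) auto
      then show "ennreal (real x powr \<beta>) \<le>
          ennreal (K powr \<beta>) * 1 + ennreal (K powr (\<beta> - 1)) * ennreal (real x)"
        by (simp add: ennreal_mult)
    qed
    also have "\<dots> = ennreal (K powr \<beta>) * ennreal (P n) +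
        ennreal (K powr (\<beta> - 1)) * killed ?B x0 n (\<lambda>x. ennreal (real x))"
      by (simp only: killed_add killed_cmult killed_one P_def)
    also have "\<dots> \<le> ennreal (K powr \<beta>) * ennreal (P n) +
        ennreal (K powr (\<beta> - 1)) * ennreal (D * n powr (1 - \<alpha>))"
      using D(2)[OF n(1)] by (intro add_left_mono mult_left_mono) auto
    also have "\<dots> = ennreal (K powr \<beta> * P n + K powr (\<beta> - 1) * (D * n powr (1 - \<alpha>)))"
      using D(1) by (simp add: ennreal_mult P_def)
    finally have "w \<le> K powr \<beta> * P n + K powr (\<beta> - 1) * (D * n powr (1 - \<alpha>))"
      using D(1) by (subst (asm) ennreal_le_iff) (auto simp: P_def)
    also have "K powr (\<beta> - 1) * (D * n powr (1 - \<alpha>)) = w / 2"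
    proof -
      have "s * (\<beta> - 1) = - (1 - \<alpha>)" using \<beta>(2) by (simp add: s_def field_simps)
      then have "K powr (\<beta> - 1) = G powr (\<beta> - 1) * n powr (- (1 - \<alpha>))"
        by (simp add: K_def powr_mult powr_powr)
      then have "K powr (\<beta> - 1) * (D * n powr (1 - \<alpha>)) =
          D * G powr (\<beta> - 1) * (n powr (- (1 - \<alpha>)) * n powr (1 - \<alpha>))"
        by simp
      also have "n powr (- (1 - \<alpha>)) * n powr (1 - \<alpha>) = 1"
        using n powr_add[of "real n" "- (1 - \<alpha>)" "1 - \<alpha>"] by simp
      finally show ?thesis by (simp add: G_powr)
    qed
    finally have "w / 2 \<le> K powr \<beta> * P n" by simp
    then have "K powr (- \<beta>) * (w / 2) \<le> K powr (- \<beta>) * (K powr \<beta> * P n)"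
      by (intro mult_left_mono) auto
    also have "\<dots> = P n" using K by (simp add: powr_minus)
    finally show ?thesis
      by (simp add: K_def powr_mult powr_powr mult_ac)
  qed
  have P_mono: "P (n + k) \<le> P n" for n
    unfolding P_def by (intro finite_measure_mono) (auto simp: stays_in_def)
  show thesis
  proof (rule that[of "w / 2 * G powr (- \<beta>) * real (1 + k) powr (- \<beta> * s)"])
    show "0 < w / 2 * G powr (- \<beta>) * real (1 + k) powr (- \<beta> * s)" using w(1) G by simp
    fix n :: nat assume n: "1 \<le> n"
    have "0 \<le> s" using \<alpha>1 \<beta>(2) by (simp add: s_def)
    have "1 / n powr \<gamma> = real n powr (- \<gamma>)" by (simp add: powr_minus_divide)
    also have "\<dots> \<le> real n powr (- \<beta> * s)"
      using n \<gamma>_ge by (intro powr_mono) (auto simp: s_def)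
    finally have "real (1 + k) powr (- \<beta> * s) * (1 / n powr \<gamma>) \<le>
        real (1 + k) powr (- \<beta> * s) * real n powr (- \<beta> * s)"
      by (intro mult_left_mono) auto
    also have "\<dots> = (real (1 + k) * real n) powr (- \<beta> * s)" by (simp add: powr_mult)
    also have "\<dots> \<le> real (n + k) powr (- \<beta> * s)"
    proof (intro powr_mono2')
      show "real (n + k) \<le> real (1 + k) * real n"
        using n by (simp add: distrib_right mult_left_le[of 1] del: of_nat_add flip: of_nat_mult of_nat_add of_nat_Suc)
    qed (use n \<open>0 \<le> s\<close> \<beta>0 in auto)
    finally have "w / 2 * G powr (- \<beta>) * (real (1 + k) powr (- \<beta> * s) * (1 / n powr \<gamma>)) \<le>
        w / 2 * G powr (- \<beta>) * real (n + k) powr (- \<beta> * s)"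
      using w(1) by (intro mult_left_mono) auto
    also have "\<dots> \<le> P (n + k)" using n by (intro late) auto
    also have "\<dots> \<le> P n" by (rule P_mono)
    finally show "w / 2 * G powr (- \<beta>) * real (1 + k) powr (- \<beta> * s) / n powr \<gamma> \<le>
        prob {\<omega> \<in> space M. stays_in ?B x0 n \<omega>}"
      by (simp add: P_def)
  qed
qed

end

theorem proposition5p2:
  fixes M :: "'a measure"
    and \<xi> :: "nat \<Rightarrow> nat \<Rightarrow> 'a \<Rightarrow> nat" and I :: "nat \<Rightarrow> 'a \<Rightarrow> nat"
    and c d \<delta> \<theta> :: real
  assumes "gw_immigration M \<xi> I"
    and "integrable M (\<lambda>\<omega>. real (\<xi> 1 1 \<omega>))"
    and "prob_space.expectation M (\<lambda>\<omega>. real (\<xi> 1 1 \<omega>)) = 1"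
    and "prob_space.variance M (\<lambda>\<omega>. real (\<xi> 1 1 \<omega>)) = d" and "d > 0"
    and "\<delta> > 0"
    and "integrable M (\<lambda>\<omega>. real (\<xi> 1 1 \<omega>) powr (2 + \<delta>))"
    and "integrable M (\<lambda>\<omega>. real (I 1 \<omega>))"
    and "prob_space.expectation M (\<lambda>\<omega>. real (I 1 \<omega>)) = c" and "c > 0"
    and "integrable M (\<lambda>\<omega>. real (I 1 \<omega>) powr (2 + \<delta>))"
    and "\<theta> = 2 * c / d" and "\<theta> < 1"
  shows "\<exists>A::real. A > 0 \<and>
    (\<forall>x0::nat. real x0 > A \<longrightarrow>
      (\<forall>\<alpha> \<beta> :: real. \<alpha> < 1 - \<theta> \<and> 1 - \<theta> < \<beta> \<longrightarrow>
        (\<exists>C\<^sub>\<alpha> C\<^sub>\<beta> :: real. C\<^sub>\<alpha> > 0 \<and> C\<^sub>\<beta> > 0 \<and>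
          (\<forall>n::nat. n \<ge> 1 \<longrightarrow>
            C\<^sub>\<beta> / real n powr \<beta> \<le> measure (gw_law M \<xi> I x0) {X. hitting_time A X > enat n} \<and>
            measure (gw_law M \<xi> I x0) {X. hitting_time A X > enat n} \<le> C\<^sub>\<alpha> / real n powr \<alpha>))))"
proof -
  interpret gw_immigration M \<xi> I by fact
  define r where "r = min 3 (2 + \<delta>)"
  have r: "2 < r" "r \<le> 3" "r \<le> 2 + \<delta>" using assms(6) by (auto simp: r_def)
  interpret critical_gw_immigration M \<xi> I c d r
  proof
    show "integrable M (\<lambda>\<omega>. real (\<xi> 1 1 \<omega>) powr r)"
      using integrable_abs_powr_smaller[of "\<lambda>\<omega>. real (\<xi> 1 1 \<omega>)" "2 + \<delta>" r] assms(7) r by simp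
    show "integrable M (\<lambda>\<omega>. real (I 1 \<omega>) powr r)"
      using integrable_abs_powr_smaller[of "\<lambda>\<omega>. real (I 1 \<omega>)" "2 + \<delta>" r] assms(11) r by simp
    show "expectation (\<lambda>\<omega>. (real (\<xi> 1 1 \<omega>) - 1)\<^sup>2) = d" using assms(3,4) by simp
    show "2 * c < d" using assms(13,5) unfolding assms(12) by (simp add: divide_less_eq)
  qed (use assms r in auto)
  have crit: "crit = 1 - \<theta>" by (simp add: crit_def assms(12))
  \<comment> \<open>Any level \<open>A\<close> that a single immigration can respect will do; by the mean, \<open>c + 1\<close> is one.\<close>
  obtain A :: real where A: "0 < A" "0 < prob {\<omega> \<in> space M. real (I 1 \<omega>) \<le> A}"
  proof -
    have "0 < prob {\<omega> \<in> space M. real (I 1 \<omega>) \<le> c + 1}"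
    proof (rule ccontr)
      assume "\<not> ?thesis"
      then have "prob {\<omega> \<in> space M. real (I 1 \<omega>) \<le> c + 1} = 0"
        using measure_nonneg[of M "{\<omega> \<in> space M. real (I 1 \<omega>) \<le> c + 1}"] by linarith
      then have "AE \<omega> in M. \<not> real (I 1 \<omega>) \<le> c + 1"
        by (subst (asm) prob_eq_0) (auto elim: eventually_mono)
      then have "AE \<omega> in M. c + 1 \<le> real (I 1 \<omega>)" by eventually_elim auto
      then have "expectation (\<lambda>_. c + 1) \<le> expectation (\<lambda>\<omega>. real (I 1 \<omega>))"
        using I_int by (intro integral_mono_AE) auto
      then show False using I_mean by (simp add: prob_space)
    qed
    then show thesis using that[of "c + 1"] c_pos by simp
  qed
  have "\<exists>C\<^sub>\<alpha> C\<^sub>\<beta> :: real. C\<^sub>\<alpha> > 0 \<and> C\<^sub>\<beta> > 0 \<and>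
      (\<forall>n::nat. n \<ge> 1 \<longrightarrow>
        C\<^sub>\<beta> / real n powr \<beta> \<le> measure (gw_law M \<xi> I x0) {X. hitting_time A X > enat n} \<and>
        measure (gw_law M \<xi> I x0) {X. hitting_time A X > enat n} \<le> C\<^sub>\<alpha> / real n powr \<alpha>)"
    if x0: "A < real x0" and \<alpha>: "\<alpha> < 1 - \<theta>" and \<beta>: "1 - \<theta> < \<beta>" for x0 :: nat and \<alpha> \<beta> :: real
  proof -
    \<comment> \<open>The upper bound needs a positive exponent, while \<open>\<alpha>\<close> may be negative.\<close>
    define a where "a = max \<alpha> (crit / 2)"
    have a: "0 < a" "a < crit" "\<alpha> \<le> a"
      using \<alpha> crit crit_bounds(1) by (auto simp: a_def less_max_iff_disj)
    obtain C1 where C1: "0 < C1" "\<And>n. 1 \<le> n \<Longrightarrow>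
        prob {\<omega> \<in> space M. stays_in (\<lambda>_. {x. A < real x}) x0 n \<omega>} \<le> C1 / n powr a"
      using survival_upper_bound[OF A a(1,2) x0] by blast
    obtain C2 where C2: "0 < C2" "\<And>n. 1 \<le> n \<Longrightarrow>
        C2 / n powr \<beta> \<le> prob {\<omega> \<in> space M. stays_in (\<lambda>_. {x. A < real x}) x0 n \<omega>}"
      using survival_lower_bound[OF A x0, of \<beta>] \<beta> unfolding crit by blast
    have "C1 / n powr a \<le> C1 / n powr \<alpha>" if "1 \<le> n" for n :: nat
      using that C1(1) a(3) by (intro divide_left_mono powr_mono) auto
    then have "prob {\<omega> \<in> space M. stays_in (\<lambda>_. {x. A < real x}) x0 n \<omega>} \<le> C1 / n powr \<alpha>"
      if "1 \<le> n" for n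
      using C1(2)[OF that] that by (meson order_trans)
    then show ?thesis
      using C1(1) C2 unfolding gw_law_hitting_time by blast
  qed
  then show ?thesis using A(1) by blast
qed

end
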